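(* Let $\kappa$ and $\lambda$ be cardinals with $\omega < \kappa = \mathrm{cf}\,\lambda$ and $2^\kappa < \lambda$. Suppose there is a normal nice filter on $\kappa$. Then $\lambda \rightarrow (\lambda,\ \omega+1)^2$.
   Context: Partition notation: for a cardinal $\lambda$ and an ordinal $\zeta$, $\lambda \rightarrow (\lambda,\ \zeta)^2$ means that for every coloring $c:[\lambda]^2 \to \{\text{red},\text{green}\}$ there is either a set $X\subseteq\lambda$ of cardinality $\lambda$ with $c$ constantly red on $[X]^2$, or a set $Y\subseteq \lambda$ of order type $\zeta$ with $c$ constantly green on $[Y]^2$. Nice filters: Let $D$ be a normal filter on $\kappa$ and $g$ an ordinal-valued function with domain $\kappa$. For a filter $E$ on $\kappa$, $E^+$ denotes the family of $E$-positive sets (subsets of $\kappa$ whose complement is not in $E$), and for functions $h,h'$ on $\kappa$, $h <_E h'$ means $\{\gamma<\kappa : h(\gamma)<h'(\gamma)\}\in E$. The game $Gw^*(D,g)$ is played as follows: on move $0$, player I plays $D_0 := D$, and player II plays some $A_0 \in D_0^+$ and $g_0 := g$. On move $n+1$, player I plays a normal filter $D_{n+1}$ on $\kappa$ extending $D_n \cup \{A_n\}$, and player II plays $A_{n+1} \in D_{n+1}^+$ together with an ordinal-valued function $g_{n+1}$ on $\kappa$ with $g_{n+1} <_{D^*_{n+1}} g_n$, where $D^*_{n+1}$ is the normal filter on $\kappa$ generated by $D_{n+1}\cup\{A_{n+1}\}$. Player I wins if at some stage $n+1$ player II has no legal move. A normal filter $D$ on $\kappa$ is nice if for every ordinal-valued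 function $g$ with domain $\kappa$, player I has a winning strategy in $Gw^*(D,g)$. *)

theory Defs
  imports Main "HOL-Library.Ramsey" "HOL-Library.Extended_Nat"
begin

unbundle cardinal_syntax

text \<open>Ordinals are well-orders up to \<open>=o\<close>, compared by \<open><o\<close> and \<open>\<le>o\<close>; a cardinal is a
  relation \<open>\<kappa>\<close> with \<open>Card_order \<kappa>\<close>, whose elements are those of \<open>Field \<kappa>\<close>.\<close>

definition has_cofinality :: "'l rel \<Rightarrow> 'k rel \<Rightarrow> bool" where
  "has_cofinality r \<kappa> \<longleftrightarrow>
     (\<exists>A \<subseteq> Field r. cofinal A r \<and> |A| =o \<kappa>) \<and>
     (\<forall>A \<subseteq> Field r. cofinal A r \<longrightarrow> \<kappa> \<le>o |A| )"

datatype colour = Red | Green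

definition arrow2 :: "'l rel \<Rightarrow> 'm rel \<Rightarrow> 'z rel \<Rightarrow> bool" where
  "arrow2 r \<mu> \<zeta> \<longleftrightarrow>
     (\<forall>c :: 'l set \<Rightarrow> colour.
        (\<exists>X \<subseteq> Field r. |X| =o \<mu> \<and> (\<forall>p \<in> [X]\<^bsup>2\<^esup>. c p = Red)) \<or>
        (\<exists>Y \<subseteq> Field r. Restr r Y =o \<zeta> \<and> (\<forall>p \<in> [Y]\<^bsup>2\<^esup>. c p = Green)))"

text \<open>\<open>enat\<close> is \<open>nat\<close> with one further, largest element.\<close>

definition omega_plus_one :: "enat rel" where
  "omega_plus_one = {(m, n). m \<le> n}"

definition diag_Inter :: "'k rel \<Rightarrow> ('k \<Rightarrow> 'k set) \<Rightarrow> 'k set" where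
  "diag_Inter \<kappa> X = {\<beta> \<in> Field \<kappa>. \<forall>\<xi> \<in> underS \<kappa> \<beta>. \<beta> \<in> X \<xi>}"

definition filter_on :: "'k set \<Rightarrow> 'k set set \<Rightarrow> bool" where
  "filter_on K D \<longleftrightarrow> D \<subseteq> Pow K \<and> K \<in> D \<and> {} \<notin> D \<and>
     (\<forall>A \<in> D. \<forall>B \<in> D. A \<inter> B \<in> D) \<and> (\<forall>A \<in> D. \<forall>B. A \<subseteq> B \<and> B \<subseteq> K \<longrightarrow> B \<in> D)"

text \<open>As usual, a normal filter contains the complements of the bounded sets. Without this clause
  the principal ultrafilters would qualify.\<close>

definition normal_filter :: "'k rel \<Rightarrow> 'k set set \<Rightarrow> bool" where
  "normal_filter \<kappa> D \<longleftrightarrow> filter_on (Field \<kappa>) D \<and>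
     (\<forall>\<alpha> \<in> Field \<kappa>. aboveS \<kappa> \<alpha> \<in> D) \<and>
     (\<forall>X. (\<forall>\<xi> \<in> Field \<kappa>. X \<xi> \<in> D) \<longrightarrow> diag_Inter \<kappa> X \<in> D)"

definition positive_sets :: "'k rel \<Rightarrow> 'k set set \<Rightarrow> 'k set set" where
  "positive_sets \<kappa> D = {A. A \<subseteq> Field \<kappa> \<and> Field \<kappa> - A \<notin> D}"

definition normal_filter_gen :: "'k rel \<Rightarrow> 'k set set \<Rightarrow> 'k set set" where
  "normal_filter_gen \<kappa> S = \<Inter> {E. normal_filter \<kappa> E \<and> S \<subseteq> E}"

definition ord_valued :: "'k rel \<Rightarrow> ('k \<Rightarrow> 'o rel) \<Rightarrow> bool" where
  "ord_valued \<kappa> g \<longleftrightarrow> (\<forall>\<gamma> \<in> Field \<kappa>. Well_order (g \<gamma>))"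

definition less_mod :: "'k rel \<Rightarrow> 'k set set \<Rightarrow> ('k \<Rightarrow> 'o rel) \<Rightarrow> ('k \<Rightarrow> 'o rel) \<Rightarrow> bool" where
  "less_mod \<kappa> E h h' \<longleftrightarrow> {\<gamma> \<in> Field \<kappa>. h \<gamma> <o h' \<gamma>} \<in> E"

text \<open>Legal moves \<open>n + 1\<close>: \<open>E, A, h\<close> are \<open>D\<^sub>n, A\<^sub>n, g\<^sub>n\<close>, and \<open>E', A', h'\<close> are their successors.\<close>

definition legal_I :: "'k rel \<Rightarrow> 'k set set \<Rightarrow> 'k set \<Rightarrow> 'k set set \<Rightarrow> bool" where
  "legal_I \<kappa> E A E' \<longleftrightarrow> normal_filter \<kappa> E' \<and> E \<union> {A} \<subseteq> E'"

definition legal_II ::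
  "'k rel \<Rightarrow> 'k set set \<Rightarrow> ('k \<Rightarrow> 'o rel) \<Rightarrow> 'k set \<Rightarrow> ('k \<Rightarrow> 'o rel) \<Rightarrow> bool" where
  "legal_II \<kappa> E' h A' h' \<longleftrightarrow> A' \<in> positive_sets \<kappa> E' \<and> ord_valued \<kappa> h' \<and>
     less_mod \<kappa> (normal_filter_gen \<kappa> (E' \<union> {A'})) h' h"

text \<open>A strategy of player I maps the list \<open>[(A\<^sub>0, g\<^sub>0), \<dots>, (A\<^sub>n, g\<^sub>n)]\<close> of the moves of player II to
  \<open>D\<^sub>n\<^sub>+\<^sub>1\<close>. The lists in \<open>Gw_play\<close> are those which arise when player I follows \<open>\<sigma>\<close> and player II
  moves legally.\<close>

type_synonym ('k, 'o) strategy = "('k set \<times> ('k \<Rightarrow> 'o rel)) list \<Rightarrow> 'k set set"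

inductive Gw_play ::
  "'k rel \<Rightarrow> 'k set set \<Rightarrow> ('k \<Rightarrow> 'o rel) \<Rightarrow> ('k, 'o) strategy \<Rightarrow>
     ('k set \<times> ('k \<Rightarrow> 'o rel)) list \<Rightarrow> bool"
  for \<kappa> D g \<sigma> where
  start: "A \<in> positive_sets \<kappa> D \<Longrightarrow> Gw_play \<kappa> D g \<sigma> [(A, g)]"
| step: "Gw_play \<kappa> D g \<sigma> ms \<Longrightarrow> legal_II \<kappa> (\<sigma> ms) (snd (last ms)) A' h' \<Longrightarrow>
           Gw_play \<kappa> D g \<sigma> (ms @ [(A', h')])"

text \<open>The filter \<open>D\<^sub>n\<close> to which the last move \<open>(A\<^sub>n, g\<^sub>n)\<close> of the list responds.\<close>

definition current_filter ::
  "'k set set \<Rightarrow> ('k, 'o) strategy \<Rightarrow> ('k set \<times> ('k \<Rightarrow> 'o rel)) list \<Rightarrow> 'k set set" where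
  "current_filter D \<sigma> ms = (if butlast ms = [] then D else \<sigma> (butlast ms))"

text \<open>The plays lost by player I are the infinite ones, together with those in which player I makes
  an illegal move.\<close>

definition winning_I :: "'k rel \<Rightarrow> 'k set set \<Rightarrow> ('k \<Rightarrow> 'o rel) \<Rightarrow> ('k, 'o) strategy \<Rightarrow> bool" where
  "winning_I \<kappa> D g \<sigma> \<longleftrightarrow>
     (\<forall>ms. Gw_play \<kappa> D g \<sigma> ms \<longrightarrow>
        legal_I \<kappa> (current_filter D \<sigma> ms) (fst (last ms)) (\<sigma> ms)) \<and>
     \<not> (\<exists>m. \<forall>n. Gw_play \<kappa> D g \<sigma> (map m [0..<Suc n]))"

text \<open>A formula cannot quantify over well-orders of all types, so \<open>nice\<close> takes its ordinals on the
  type \<open>'k set set\<close>, the type of the moves of player I. This is no restriction: by \<open>nice_all_ordinals\<close>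
  below, a nice filter has the defining property for ordinals of any type.\<close>

definition nice :: "'k rel \<Rightarrow> 'k set set \<Rightarrow> bool" where
  "nice \<kappa> D \<longleftrightarrow>
     (\<forall>g :: 'k \<Rightarrow> 'k set set rel. ord_valued \<kappa> g \<longrightarrow> (\<exists>\<sigma>. winning_I \<kappa> D g \<sigma>))"


text \<open>Positions \<open>(D\<^sub>n, A\<^sub>n, g\<^sub>n)\<close> from which player I can force a win.\<close>

inductive won :: "'k rel \<Rightarrow> 'k set set \<Rightarrow> 'k set \<Rightarrow> ('k \<Rightarrow> 'o rel) \<Rightarrow> bool" for \<kappa> where
  "legal_I \<kappa> E A E' \<Longrightarrow> (\<And>A' h'. legal_II \<kappa> E' h A' h' \<Longrightarrow> won \<kappa> E' A' h') \<Longrightarrow> won \<kappa> E A h"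

lemma Gw_play_not_Nil: "Gw_play \<kappa> D g \<sigma> ms \<Longrightarrow> ms \<noteq> []"
  by (induction rule: Gw_play.induct) auto

lemma winning_I_imp_won:
  assumes win: "winning_I \<kappa> D g \<sigma>" and A: "A \<in> positive_sets \<kappa> D"
  shows "won \<kappa> D A g"
proof (rule ccontr)
  assume nw: "\<not> won \<kappa> D A g"
  define Q where "Q ms \<longleftrightarrow> Gw_play \<kappa> D g \<sigma> ms \<and>
    \<not> won \<kappa> (current_filter D \<sigma> ms) (fst (last ms)) (snd (last ms))" for ms
  have Q0: "Q [(A, g)]"
    using nw A by (auto simp: Q_def current_filter_def intro: Gw_play.start)
  have Qstep: "\<exists>m. Q (ms @ [m])" if "Q ms" for ms
  proof -
    have p: "Gw_play \<kappa> D g \<sigma> ms"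
      and n: "\<not> won \<kappa> (current_filter D \<sigma> ms) (fst (last ms)) (snd (last ms))"
      using that by (auto simp: Q_def)
    have "legal_I \<kappa> (current_filter D \<sigma> ms) (fst (last ms)) (\<sigma> ms)"
      using win p by (auto simp: winning_I_def)
    with n obtain A' h' where 1: "legal_II \<kappa> (\<sigma> ms) (snd (last ms)) A' h'"
      and 2: "\<not> won \<kappa> (\<sigma> ms) A' h'"
      using won.intros by meson
    have "Q (ms @ [(A', h')])"
      using Gw_play.step[OF p 1] 2 Gw_play_not_Nil[OF p] by (simp add: Q_def current_filter_def)
    then show ?thesis ..
  qed
  define nxt where "nxt ms = (SOME m. Q (ms @ [m]))" for ms
  define f where "f = rec_nat [(A, g)] (\<lambda>_ ms. ms @ [nxt ms])"
  have f0: "f 0 = [(A, g)]" and fS: "f (Suc n) = f n @ [nxt (f n)]" for n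
    by (simp_all add: f_def)
  have Qf: "Q (f n)" for n
    by (induction n) (use Q0 Qstep in \<open>auto simp: f0 fS nxt_def intro: someI_ex\<close>)
  define m where "m n = last (f n)" for n
  have "f n = map m [0..<Suc n]" for n
    by (induction n) (auto simp: f0 fS m_def)
  then have "Gw_play \<kappa> D g \<sigma> (map m [0..<Suc n])" for n
    using Qf[of n] by (simp add: Q_def)
  then show False
    using win by (auto simp: winning_I_def)
qed

primrec run ::
  "'k rel \<Rightarrow> ('k, 'o) strategy \<Rightarrow> ('k \<Rightarrow> 'o rel) \<Rightarrow> ('k set \<times> ('k \<Rightarrow> 'o rel)) list \<Rightarrow> bool" where
  "run \<kappa> \<sigma> h [] \<longleftrightarrow> True"
| "run \<kappa> \<sigma> h (m # ms) \<longleftrightarrow> legal_II \<kappa> (\<sigma> []) h (fst m) (snd m) \<and> run \<kappa> (\<lambda>l. \<sigma> (m # l)) (snd m) ms"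

primrec sound ::
  "'k rel \<Rightarrow> ('k, 'o) strategy \<Rightarrow> 'k set set \<Rightarrow> 'k set \<Rightarrow> ('k set \<times> ('k \<Rightarrow> 'o rel)) list \<Rightarrow> bool"
  where
  "sound \<kappa> \<sigma> E A [] \<longleftrightarrow> legal_I \<kappa> E A (\<sigma> [])"
| "sound \<kappa> \<sigma> E A (m # ms) \<longleftrightarrow> sound \<kappa> (\<lambda>l. \<sigma> (m # l)) (\<sigma> []) (fst m) ms"

lemma run_snoc:
  "run \<kappa> \<sigma> h (ms @ [m]) \<longleftrightarrow>
     run \<kappa> \<sigma> h ms \<and> legal_II \<kappa> (\<sigma> ms) (snd (last ((A, h) # ms))) (fst m) (snd m)"
  by (induction ms arbitrary: \<sigma> h A) (auto split: if_splits)

lemma sound_snoc: "sound \<kappa> \<sigma> E A (ms @ [m]) \<longleftrightarrow> legal_I \<kappa> (\<sigma> ms) (fst m) (\<sigma> (ms @ [m]))"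
  by (induction ms arbitrary: \<sigma> E A) auto

lemma won_imp_strategy:
  fixes h :: "'k \<Rightarrow> 'o rel"
  assumes "won \<kappa> E A h"
  shows "\<exists>\<sigma>. (\<forall>ms. run \<kappa> \<sigma> h ms \<longrightarrow> sound \<kappa> \<sigma> E A ms) \<and>
           \<not> (\<exists>m. \<forall>n. run \<kappa> \<sigma> h (map m [0..<n]))"
  using assms
proof (induction rule: won.induct)
  case (1 E A E' h)
  define good where "good \<tau> m \<longleftrightarrow>
      (\<forall>ms. run \<kappa> \<tau> (snd m) ms \<longrightarrow> sound \<kappa> \<tau> E' (fst m) ms) \<and>
      \<not> (\<exists>f. \<forall>n. run \<kappa> \<tau> (snd m) (map f [0..<n]))" for \<tau> :: "('k, 'o) strategy" and m
  have "\<forall>m. \<exists>\<tau>. legal_II \<kappa> E' h (fst m) (snd m) \<longrightarrow> good \<tau> m"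
    using "1.IH" unfolding good_def by blast
  then obtain \<tau> where \<tau>: "\<And>m. legal_II \<kappa> E' h (fst m) (snd m) \<Longrightarrow> good (\<tau> m) m"
    by metis
  define \<sigma> where "\<sigma> ms = (case ms of [] \<Rightarrow> E' | m # l \<Rightarrow> \<tau> m l)" for ms
  have [simp]: "\<sigma> [] = E'" "(\<lambda>l. \<sigma> (m # l)) = \<tau> m" for m
    by (auto simp: \<sigma>_def)
  have "sound \<kappa> \<sigma> E A ms" if "run \<kappa> \<sigma> h ms" for ms
    using that \<tau> 1(1) by (cases ms) (auto simp: good_def)
  moreover have False if "\<forall>n. run \<kappa> \<sigma> h (map f [0..<n])" for f
  proof -
    have *: "map f [0..<Suc n] = f 0 # map (f \<circ> Suc) [0..<n]" for n
      by (simp add: map_upt_Suc del: upt_Suc)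
    have r: "run \<kappa> \<sigma> h (f 0 # map (f \<circ> Suc) [0..<n])" for n
      using that *[of n] by metis
    then have "legal_II \<kappa> E' h (fst (f 0)) (snd (f 0))"
      by simp
    moreover have "\<forall>n. run \<kappa> (\<tau> (f 0)) (snd (f 0)) (map (f \<circ> Suc) [0..<n])"
      using r by simp
    ultimately show False
      using \<tau> unfolding good_def by blast
  qed
  ultimately show ?case
    by blast
qed

lemma won_imp_winning_I:
  fixes g :: "'k \<Rightarrow> 'o rel"
  assumes "\<And>A. A \<in> positive_sets \<kappa> D \<Longrightarrow> won \<kappa> D A g"
  shows "\<exists>\<sigma>. winning_I \<kappa> D g \<sigma>"
proof -
  define good where "good \<tau> A \<longleftrightarrow> (\<forall>ms. run \<kappa> \<tau> g ms \<longrightarrow> sound \<kappa> \<tau> D A ms) \<and>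
      \<not> (\<exists>f. \<forall>n. run \<kappa> \<tau> g (map f [0..<n]))" for \<tau> :: "('k, 'o) strategy" and A
  have "\<forall>A. \<exists>\<tau>. A \<in> positive_sets \<kappa> D \<longrightarrow> good \<tau> A"
    using assms won_imp_strategy unfolding good_def by blast
  then obtain \<tau> where \<tau>: "\<And>A. A \<in> positive_sets \<kappa> D \<Longrightarrow> good (\<tau> A) A"
    by metis
  define \<sigma> where "\<sigma> ms = \<tau> (fst (hd ms)) (tl ms)" for ms :: "('k set \<times> ('k \<Rightarrow> 'o rel)) list"
  have play: "\<exists>A l. ms = (A, g) # l \<and> A \<in> positive_sets \<kappa> D \<and> run \<kappa> (\<tau> A) g l"
    if "Gw_play \<kappa> D g \<sigma> ms" for ms
    using that
  proof (induction rule: Gw_play.induct)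
    case (start A)
    then show ?case by simp
  next
    case (step ms A' h')
    then obtain A l where l: "ms = (A, g) # l" "A \<in> positive_sets \<kappa> D" "run \<kappa> (\<tau> A) g l"
      by blast
    then have "run \<kappa> (\<tau> A) g (l @ [(A', h')])"
      using step.hyps(2) by (subst run_snoc[where A = A]) (simp add: \<sigma>_def)
    with l show ?case
      by auto
  qed
  have "winning_I \<kappa> D g \<sigma>"
    unfolding winning_I_def
  proof (intro conjI allI impI notI)
    fix ms assume "Gw_play \<kappa> D g \<sigma> ms"
    then obtain A l where l: "ms = (A, g) # l" "A \<in> positive_sets \<kappa> D" "run \<kappa> (\<tau> A) g l"
      using play by blast
    then have s: "sound \<kappa> (\<tau> A) D A l"
      using \<tau> by (auto simp: good_def)
    show "legal_I \<kappa> (current_filter D \<sigma> ms) (fst (last ms)) (\<sigma> ms)"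
    proof (cases l rule: rev_cases)
      case Nil
      then show ?thesis using s l by (simp add: current_filter_def \<sigma>_def)
    next
      case (snoc l' m)
      then show ?thesis using s l by (simp add: sound_snoc current_filter_def \<sigma>_def butlast_append)
    qed
  next
    assume "\<exists>m. \<forall>n. Gw_play \<kappa> D g \<sigma> (map m [0..<Suc n])"
    then obtain m where m: "Gw_play \<kappa> D g \<sigma> (map m [0..<Suc n])" for n
      by blast
    have *: "map m [0..<Suc n] = m 0 # map (m \<circ> Suc) [0..<n]" for n
      by (simp add: map_upt_Suc del: upt_Suc)
    have "fst (m 0) \<in> positive_sets \<kappa> D \<and> run \<kappa> (\<tau> (fst (m 0))) g (map (m \<circ> Suc) [0..<n])" for n
      using play[OF m[of n]] unfolding * by auto
    then show False
      using \<tau> unfolding good_def by blast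
  qed
  then show ?thesis
    by (rule exI[where x = \<sigma>])
qed

lemma ordinal_collapse:
  fixes q :: "'i \<Rightarrow> 'o rel"
  assumes wo: "\<And>x. x \<in> X \<Longrightarrow> Well_order (q x)" and card: "|X| \<le>o |UNIV :: 't set|"
  shows "\<exists>c :: 'i \<Rightarrow> 't rel. (\<forall>x \<in> X. Well_order (c x)) \<and>
           (\<forall>x \<in> X. \<forall>y \<in> X. q x <o q y \<longrightarrow> c x <o c y)"
proof -
  obtain f :: "'i \<Rightarrow> 't" where f: "inj_on f X"
    using card by (auto simp: card_of_ordLeq[symmetric])
  define rep where "rep x = (SOME y. y \<in> X \<and> q y =o q x)" for x
  have rep: "rep x \<in> X" "q (rep x) =o q x" if "x \<in> X" for x
    using someI[of "\<lambda>y. y \<in> X \<and> q y =o q x" x] that wo ordIso_reflexive by (auto simp: rep_def)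
  have rep_eq: "rep x = rep y" if "x \<in> X" "y \<in> X" "q x =o q y" for x y
  proof -
    have "(z \<in> X \<and> q z =o q x) = (z \<in> X \<and> q z =o q y)" for z
      using that ordIso_transitive ordIso_symmetric by blast
    then show ?thesis by (simp add: rep_def)
  qed
  define e where "e x = f (rep x)" for x
  have e: "q x =o q y" if "e x = e y" "x \<in> X" "y \<in> X" for x y
  proof -
    have "rep x = rep y"
      using that f rep(1) by (auto simp: e_def inj_on_def)
    then show ?thesis
      using rep(2) that ordIso_transitive ordIso_symmetric by metis
  qed
  define r where "r = {(e x, e y) | x y. x \<in> X \<and> y \<in> X \<and> q x \<le>o q y}"
  have r_iff: "(e x, e y) \<in> r \<longleftrightarrow> q x \<le>o q y" if "x \<in> X" "y \<in> X" for x y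
  proof
    assume "(e x, e y) \<in> r"
    then obtain x' y' where "e x = e x'" "e y = e y'" "x' \<in> X" "y' \<in> X" "q x' \<le>o q y'"
      by (auto simp: r_def)
    then show "q x \<le>o q y"
      using e that by (meson ordIso_ordLeq_trans ordLeq_ordIso_trans ordIso_symmetric)
  qed (use that in \<open>auto simp: r_def\<close>)
  have Field: "Field r = e ` X"
    using wo ordLeq_reflexive by (fastforce simp: r_def Field_def)
  have eq: "e x = e y" if "x \<in> X" "y \<in> X" "q x =o q y" for x y
    using rep_eq[OF that] by (simp add: e_def)
  have strict: "q x <o q y" if "x \<in> X" "y \<in> X" "(e x, e y) \<in> r" "e x \<noteq> e y" for x y
    using that r_iff eq ordLeq_iff_ordLess_or_ordIso by blast
  define d where "d t = (SOME x. x \<in> X \<and> e x = t)" for t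
  have d: "d t \<in> X" "e (d t) = t" if "t \<in> e ` X" for t
    using that someI_ex[of "\<lambda>x. x \<in> X \<and> e x = t"] by (auto simp: d_def)
  have "(s, t) \<in> inv_image ordLess (\<lambda>t. q (d t))" if "(s, t) \<in> r - Id" for s t
  proof -
    have "s \<in> e ` X" "t \<in> e ` X"
      using that by (auto simp: r_def)
    then show ?thesis
      using strict[of "d s" "d t"] d that by (simp add: in_inv_image)
  qed
  then have "r - Id \<subseteq> inv_image ordLess (\<lambda>t. q (d t))"
    by (rule subrelI)
  then have "wf (r - Id)"
    using wf_subset wf_inv_image wf_ordLess by blast
  moreover have "Refl r"
    using r_iff wo ordLeq_reflexive by (auto simp: refl_on_def Field)
  moreover have "trans r"
  proof (rule transI)
    fix a b c assume ab: "(a, b) \<in> r" and bc: "(b, c) \<in> r"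
    then obtain x y z where "a = e x" "b = e y" "c = e z" "x \<in> X" "y \<in> X" "z \<in> X"
      by (auto simp: r_def)
    with ab bc r_iff show "(a, c) \<in> r"
      by (metis ordLeq_transitive)
  qed
  moreover have "antisym r"
  proof (rule antisymI)
    fix a b assume ab: "(a, b) \<in> r" and ba: "(b, a) \<in> r"
    then obtain x y where "a = e x" "b = e y" "x \<in> X" "y \<in> X"
      by (auto simp: r_def)
    with ab ba r_iff eq show "a = b"
      by (metis ordIso_iff_ordLeq)
  qed
  moreover have "Total r"
    unfolding total_on_def Field using r_iff wo ordLeq_total by blast
  ultimately have r: "Well_order r"
    by (auto simp: well_order_on_def linear_order_on_def partial_order_on_def preorder_on_def Field_def)
  define c where "c x = Restr r (underS r (e x))" for x
  have "c x <o c y" if "x \<in> X" "y \<in> X" "q x <o q y" for x y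
  proof -
    have xy: "(e x, e y) \<in> r"
      using that r_iff ordLess_imp_ordLeq by blast
    have xy': "e x \<noteq> e y"
      using that e not_ordLess_ordIso by blast
    have "e x \<in> underS r (e y)" "e x \<notin> underS r (e x)"
      using xy xy' by (simp_all add: underS_def)
    moreover have "underS r (e x) \<subseteq> underS r (e y)"
    proof
      fix t assume "t \<in> underS r (e x)"
      then have t: "t \<noteq> e x" "(t, e x) \<in> r"
        by (simp_all add: underS_def)
      have "(t, e y) \<in> r"
        using \<open>trans r\<close> t(2) xy by (rule transD)
      moreover have "t \<noteq> e y"
        using t xy antisymD[OF \<open>antisym r\<close>] by metis
      ultimately show "t \<in> underS r (e y)"
        by (simp add: underS_def)
    qed
    ultimately have "underS r (e x) \<subset> underS r (e y)"
      by blast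
    then show ?thesis
      unfolding c_def
      by (simp add: ofilter_subset_ordLess[OF r, symmetric] wo_rel.underS_ofilter wo_rel_def r)
  qed
  moreover have "Well_order (c x)" for x
    using Well_order_Restr[OF r] by (simp add: c_def)
  ultimately show ?thesis
    by blast
qed

lemma card_of_list_ordLeq:
  assumes inf: "infinite (UNIV :: 't set)"
  shows "|UNIV :: 't list set| \<le>o |UNIV :: 't set|"
proof -
  have "|(UNIV :: 't set) \<times> (UNIV :: 't set)| \<le>o |UNIV :: 't set|"
    using card_of_Times_same_infinite[OF inf] ordIso_imp_ordLeq by blast
  then obtain p :: "'t \<times> 't \<Rightarrow> 't" where p: "inj p"
    by (auto simp: card_of_ordLeq[symmetric])
  define code where "code = rec_list undefined (\<lambda>x _ t. p (x, t))"
  have code: "code (x # s) = p (x, code s)" for x s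
    by (simp add: code_def)
  have "s = t" if "length s = length t" "code s = code t" for s t
    using that by (induction rule: list_induct2) (auto simp: code dest: injD[OF p])
  then have "inj (\<lambda>s. (length s, code s))"
    by (auto simp: inj_on_def)
  then have "|UNIV :: 't list set| \<le>o |(UNIV :: nat set) \<times> (UNIV :: 't set)|"
    by (auto simp: card_of_ordLeq[symmetric])
  moreover have "|(UNIV :: nat set) \<times> (UNIV :: 't set)| \<le>o |UNIV :: 't set|"
    using card_of_Times_infinite[OF inf, of "UNIV :: nat set"] inf infinite_iff_card_of_nat
      ordIso_imp_ordLeq by blast
  ultimately show ?thesis
    by (rule ordLeq_transitive)
qed

theorem nice_all_ordinals:
  fixes \<kappa> :: "'k rel" and g :: "'k \<Rightarrow> 'o rel"
  assumes inf: "infinite (Field \<kappa>)" and nice: "nice \<kappa> D" and g: "ord_valued \<kappa> g"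
  shows "\<exists>\<sigma>. winning_I \<kappa> D g \<sigma>"
proof (rule won_imp_winning_I, rule ccontr)
  fix A assume A: "A \<in> positive_sets \<kappa> D" and nw: "\<not> won \<kappa> D A g"
  have "\<exists>m. legal_II \<kappa> E' h (fst m) (snd m) \<and> \<not> won \<kappa> E' (fst m) (snd m)"
    if "\<not> won \<kappa> E A h" "legal_I \<kappa> E A E'" for E A E' and h :: "'k \<Rightarrow> 'o rel"
    using that won.intros[of \<kappa> E A E' h] by auto
  then obtain \<rho> where \<rho>: "legal_II \<kappa> E' h (fst (\<rho> E A h E')) (snd (\<rho> E A h E'))"
      "\<not> won \<kappa> E' (fst (\<rho> E A h E')) (snd (\<rho> E A h E'))"
    if "\<not> won \<kappa> E A h" "legal_I \<kappa> E A E'" for E A E' and h :: "'k \<Rightarrow> 'o rel"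
    by metis
  text \<open>Positions are indexed by the moves of player I, latest move first.\<close>
  define pos where "pos = rec_list (D, A, g) (\<lambda>E' _ (E, A, h). (E', \<rho> E A h E'))"
  have pos0: "pos [] = (D, A, g)"
    and posS: "pos (E' # s) = (case pos s of (E, A, h) \<Rightarrow> (E', \<rho> E A h E'))" for E' s
    by (simp_all add: pos_def)
  define ok where "ok s \<longleftrightarrow> (case pos s of (E, A, h) \<Rightarrow> \<not> won \<kappa> E A h \<and> ord_valued \<kappa> h)" for s
  define q where "q = (\<lambda>(s, i). snd (snd (pos s)) i)"
  define X where "X = {s. ok s} \<times> Field \<kappa>"
  have infk: "infinite (UNIV :: 'k set)"
    using inf by (rule infinite_super[OF subset_UNIV])
  have infkk: "infinite (UNIV :: 'k set set set)"
    using infk by (simp add: Finite_Set.finite_set)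
  have 1: "|UNIV :: 'k set| \<le>o |UNIV :: 'k set set set|"
    by (rule card_of_ordLeq[THEN iffD1], rule exI[of _ "\<lambda>x. {{x}}"]) (auto simp: inj_on_def)
  have 2: "|UNIV :: 'k set set list set| \<le>o |UNIV :: 'k set set set|"
    using card_of_list_ordLeq[OF infkk] .
  have "|(UNIV :: 'k set set list set) \<times> (UNIV :: 'k set)| \<le>o |UNIV :: 'k set set set|"
    by (rule card_of_Times_ordLeq_infinite_Field) (simp_all add: infkk 1 2 card_of_Card_order Field_card_of card_of_card_order_on del: Finite_Set.finite_set)
  then have "|X| \<le>o |UNIV :: 'k set set set|"
    using card_of_mono1[of X "UNIV \<times> UNIV"] ordLeq_transitive by (auto simp: X_def)
  moreover have "Well_order (q x)" if "x \<in> X" for x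
    using that by (auto simp: X_def q_def ok_def ord_valued_def case_prod_beta)
  ultimately obtain c :: "'k set set list \<times> 'k \<Rightarrow> 'k set set rel"
    where c: "\<And>x. x \<in> X \<Longrightarrow> Well_order (c x)"
      "\<And>x y. x \<in> X \<Longrightarrow> y \<in> X \<Longrightarrow> q x <o q y \<Longrightarrow> c x <o c y"
    using ordinal_collapse[of X q] by metis
  have no: False
    if "won \<kappa> E A f" "ok s" "pos s = (E, A, h)" "f = (\<lambda>i. c (s, i))" for E A f s h
    using that
  proof (induction arbitrary: s h rule: won.induct)
    case (1 E A E' f)
    obtain A' h' where m: "\<rho> E A h E' = (A', h')"
      by fastforce
    have nw: "\<not> won \<kappa> E A h"
      using "1.prems" by (auto simp: ok_def)
    have L: "legal_II \<kappa> E' h A' h'" and "\<not> won \<kappa> E' A' h'"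
      using \<rho>[OF nw 1(1)] m by auto
    have pos': "pos (E' # s) = (E', A', h')"
      using 1 m by (simp add: posS)
    have ok': "ok (E' # s)"
      using L \<open>\<not> won \<kappa> E' A' h'\<close> by (simp add: ok_def pos' legal_II_def)
    let ?f' = "\<lambda>i. c (E' # s, i)"
    let ?G = "normal_filter_gen \<kappa> (E' \<union> {A'})"
    have "less_mod \<kappa> ?G ?f' f"
      unfolding less_mod_def normal_filter_gen_def
    proof clarify
      fix N assume N: "normal_filter \<kappa> N" "E' \<union> {A'} \<subseteq> N"
      then have "{\<gamma> \<in> Field \<kappa>. h' \<gamma> <o h \<gamma>} \<in> N"
        using L by (auto simp: legal_II_def less_mod_def normal_filter_gen_def)
      moreover have "{\<gamma> \<in> Field \<kappa>. h' \<gamma> <o h \<gamma>} \<subseteq> {\<gamma> \<in> Field \<kappa>. ?f' \<gamma> <o f \<gamma>}"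
        using c(2) ok' "1.prems" pos' by (auto simp: X_def q_def)
      ultimately show "{\<gamma> \<in> Field \<kappa>. ?f' \<gamma> <o f \<gamma>} \<in> N"
        using N(1) unfolding normal_filter_def filter_on_def by blast
    qed
    moreover have "ord_valued \<kappa> ?f'"
      using c(1) ok' by (auto simp: ord_valued_def X_def)
    ultimately have "legal_II \<kappa> E' f A' ?f'"
      using L by (simp add: legal_II_def)
    then show False
      using "1.IH" ok' pos' by blast
  qed
  have "ok []"
    using nw g by (simp add: ok_def pos0)
  then have "ord_valued \<kappa> (\<lambda>i. c ([], i))"
    using c(1) by (auto simp: ord_valued_def X_def)
  then have "won \<kappa> D A (\<lambda>i. c ([], i))"
    using nice A winning_I_imp_won unfolding nice_def by blast
  then show False
    using no \<open>ok []\<close> pos0 by blast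
qed

end

theory Submission
  imports Defs
begin

text \<open>Suppose there is no green set of type \<open>\<omega> + 1\<close>. As \<open>lam\<close> is singular, choose red blocks
  \<open>S \<zeta>\<close> for \<open>\<zeta> < \<kappa>\<close>, increasing in \<open>lam\<close>, of size \<open>|N \<zeta>|\<^sup>+\<^sup>+\<close>, where \<open>N \<zeta>\<close> is an initial segment
  of \<open>lam\<close> which lies below \<open>S \<zeta>\<close>, contains all earlier blocks and has at least \<open>2\<^sup>\<kappa>\<close> elements.
  For \<open>x \<in> S \<zeta>\<close> the tree of finite green sets in \<open>N \<zeta>\<close> all of whose points are green to \<open>x\<close> is
  well-founded, and its ranks are below \<open>|N \<zeta>|\<^sup>+\<close>; so any large part of the block contains a large
  part on which the rank of a given node is constant. If there is no red set of size \<open>lam\<close>, then,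
  for every normal filter, some point is green to large parts of positively many blocks. Adding such
  points one after the other, player II keeps lowering the rank function, whatever player I does,
  and never loses the game; so there is no nice filter.\<close>

subsection \<open>Green sets of type \<open>\<omega> + 1\<close>\<close>

definition green :: "('a set \<Rightarrow> colour) \<Rightarrow> 'a \<Rightarrow> 'a \<Rightarrow> bool" where
  "green c x y \<longleftrightarrow> x \<noteq> y \<and> c {x, y} = Green"

lemma green_sym: "green c x y \<longleftrightarrow> green c y x"
  by (auto simp: green_def insert_commute)

definition no_green :: "'a rel \<Rightarrow> ('a set \<Rightarrow> colour) \<Rightarrow> bool" where
  "no_green r c \<longleftrightarrow>
     \<not> (\<exists>Y \<subseteq> Field r. Restr r Y =o omega_plus_one \<and> (\<forall>p \<in> [Y]\<^bsup>2\<^esup>. c p = Green))"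

lemma all_nsets_2_iff: "(\<forall>p \<in> [X]\<^bsup>2\<^esup>. P p) \<longleftrightarrow> (\<forall>x \<in> X. \<forall>y \<in> X. x \<noteq> y \<longrightarrow> P {x, y})"
proof
  assume "\<forall>p \<in> [X]\<^bsup>2\<^esup>. P p"
  moreover have "{x, y} \<in> [X]\<^bsup>2\<^esup>" if "x \<in> X" "y \<in> X" "x \<noteq> y" for x y
    using that by (simp add: nsets_def)
  ultimately show "\<forall>x \<in> X. \<forall>y \<in> X. x \<noteq> y \<longrightarrow> P {x, y}"
    by blast
qed (auto simp: nsets_def card_2_iff)

lemma Field_omega_plus_one: "Field omega_plus_one = UNIV"
  by (auto simp: omega_plus_one_def Field_def)

lemma Well_order_omega_plus_one: "Well_order omega_plus_one"
proof -
  have "omega_plus_one - Id = {(x, y). x < y}"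
    by (auto simp: omega_plus_one_def)
  then have "wf (omega_plus_one - Id)"
    using wf[where 'a = enat] by simp
  then show ?thesis
    unfolding well_order_on_def linear_order_on_def partial_order_on_def preorder_on_def
      Field_omega_plus_one
    by (auto simp: refl_on_def trans_def antisym_def total_on_def omega_plus_one_def)
qed

lemma Restr_ordIso_omega_plus_one:
  assumes r: "Well_order r" and x: "x \<in> Field r" and Z: "Z \<subseteq> underS r x" "infinite Z"
  shows "\<exists>Y \<subseteq> Z. Restr r (insert x Y) =o omega_plus_one"
proof -
  have ZF: "Z \<subseteq> Field r"
    using Z(1) by (auto simp: underS_def Field_def)
  have refl: "Refl r"
    using r by (auto simp: well_order_on_def linear_order_on_def partial_order_on_def preorder_on_def)
  have FZ: "Field (Restr r Z) = Z"
    using Refl_Field_Restr2[OF refl ZF] .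
  have woZ: "Well_order (Restr r Z)"
    using Well_order_Restr[OF r] .
  have "|Z| \<le>o Restr r Z"
    using card_of_least woZ FZ by metis
  moreover have "natLeq \<le>o |Z|"
    using Z(2) infinite_iff_natLeq_ordLeq by blast
  ultimately have "natLeq \<le>o Restr r Z"
    using ordLeq_transitive by blast
  then obtain f where f: "embed natLeq (Restr r Z) f"
    by (auto simp: ordLeq_def)
  have fZ: "f n \<in> Z" for n
    using embed_Field[OF f] FZ by (auto simp: Field_natLeq)
  have inj: "f m = f n \<Longrightarrow> m = n" for m n
    using embed_inj_on[OF natLeq_Well_order f] by (auto simp: Field_natLeq inj_on_def)
  have mono: "(f m, f n) \<in> r" if "m \<le> n" for m n
    using embed_compat[OF f] that by (auto simp: compat_def natLeq_def)
  have anti: "antisym r"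
    using r by (auto simp: well_order_on_def linear_order_on_def partial_order_on_def)
  have mono_iff: "(f m, f n) \<in> r \<longleftrightarrow> m \<le> n" for m n
  proof
    assume *: "(f m, f n) \<in> r"
    show "m \<le> n"
    proof (rule ccontr)
      assume "\<not> m \<le> n"
      then have "f m = f n" "m \<noteq> n"
        using mono[of n m] * antisymD[OF anti] by auto
      then show False
        using inj by blast
    qed
  qed (rule mono)
  have fx: "(f n, x) \<in> r" "f n \<noteq> x" "(x, f n) \<notin> r" for n
    using fZ[of n] Z(1) anti by (auto simp: underS_def dest: antisymD)
  have xx: "(x, x) \<in> r"
    using refl x by (auto simp: refl_on_def)
  define Y where "Y = range f"
  define g where "g e = (case e of enat n \<Rightarrow> f n | \<infinity> \<Rightarrow> x)" for e
  have "insert x Y \<subseteq> Field r"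
    using fZ ZF x by (auto simp: Y_def)
  then have FY: "Field (Restr r (insert x Y)) = insert x Y"
    using Refl_Field_Restr2[OF refl] by blast
  have "iso omega_plus_one (Restr r (insert x Y)) g"
    unfolding iso_iff2 FY Field_omega_plus_one
  proof (intro conjI ballI)
    have "inj g"
    proof (rule injI)
      show "a = b" if "g a = g b" for a b
        using that fx(2) inj by (cases a; cases b) (auto simp: g_def dest: sym)
    qed
    moreover have "range g = insert x Y"
    proof -
      have "(UNIV :: enat set) = insert \<infinity> (range enat)"
        using enat.exhaust by auto
      then have "range g = insert (g \<infinity>) (range (\<lambda>n. g (enat n)))"
        by (metis image_insert image_image)
      then show ?thesis
        by (simp add: g_def Y_def)
    qed
    ultimately show "bij_betw g UNIV (insert x Y)"
      by (simp add: bij_betw_def)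
    show "((a, b) \<in> omega_plus_one) = ((g a, g b) \<in> Restr r (insert x Y))" for a b
      by (cases a; cases b) (auto simp: g_def omega_plus_one_def mono_iff fx xx Y_def)
  qed
  then have "omega_plus_one =o Restr r (insert x Y)"
    unfolding ordIso_def using Well_order_omega_plus_one Well_order_Restr[OF r] by blast
  then show ?thesis
    using fZ by (intro exI[of _ Y]) (auto simp: Y_def ordIso_symmetric)
qed

text \<open>Longer lists are smaller. An infinite descending sequence, whatever its first list, adds
  infinitely many points which are green to each other and to \<open>x\<close>.\<close>

definition extend :: "('a set \<Rightarrow> colour) \<Rightarrow> 'a set \<Rightarrow> 'a \<Rightarrow> 'a list rel" where
  "extend c N x = {(y # l, l) | y l. y \<in> N \<and> green c y x \<and> (\<forall>z \<in> set l. green c y z)}"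

lemma wf_extend:
  assumes r: "Well_order r" and ng: "no_green r c" and x: "x \<in> Field r" and N: "N \<subseteq> underS r x"
  shows "wf (extend c N x)"
  unfolding wf_iff_no_infinite_down_chain
proof
  assume "\<exists>f. \<forall>i. (f (Suc i), f i) \<in> extend c N x"
  then obtain f where f: "\<And>i. (f (Suc i), f i) \<in> extend c N x"
    by blast
  define y where "y i = hd (f (Suc i))" for i
  have y: "f (Suc i) = y i # f i" "y i \<in> N" "green c (y i) x" "\<forall>z \<in> set (f i). green c (y i) z" for i
    using f[of i] by (auto simp: extend_def y_def)
  have mem: "y i \<in> set (f j)" if "i < j" for i j
    using that by (induction j) (auto simp: y(1) less_Suc_eq)
  have gr: "green c (y i) (y j)" if "i \<noteq> j" for i j
    using that y(4) mem green_sym by (metis nat_neq_iff)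
  have "inj y"
    using gr by (metis green_def injI)
  then have "infinite (range y)"
    by (rule range_inj_infinite)
  moreover have "range y \<subseteq> underS r x"
    using y(2) N by blast
  ultimately obtain Y where Y: "Y \<subseteq> range y" "Restr r (insert x Y) =o omega_plus_one"
    using Restr_ordIso_omega_plus_one[OF r x] by blast
  have "c {a, b} = Green" if "a \<in> insert x Y" "b \<in> insert x Y" "a \<noteq> b" for a b
  proof -
    have "green c a b"
    proof -
      have "\<forall>u \<in> Y. green c u x \<and> green c x u" "\<forall>u \<in> Y. \<forall>v \<in> Y. u \<noteq> v \<longrightarrow> green c u v"
        using Y(1) gr y(3) green_sym[of c x] by (blast, metis rangeE subsetD)
      then show ?thesis
        using that by auto
    qed
    then show ?thesis
      by (simp add: green_def)
  qed
  then have "\<forall>p \<in> [insert x Y]\<^bsup>2\<^esup>. c p = Green"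
    by (simp add: all_nsets_2_iff)
  moreover have "insert x Y \<subseteq> Field r"
    using x Y(1) y(2) N by (fastforce simp: underS_def Field_def)
  ultimately show False
    using ng Y(2) unfolding no_green_def by blast
qed

lemma Well_order_underS_cases:
  assumes r: "Well_order r" and ab: "a \<in> Field r" "b \<in> Field r"
  shows "a = b \<or> a \<in> underS r b \<or> b \<in> underS r a"
proof -
  have "a = b \<or> (a, b) \<in> r \<or> (b, a) \<in> r"
    using r ab unfolding well_order_on_def linear_order_on_def total_on_def by blast
  then show ?thesis
    by (auto simp: underS_def)
qed

subsection \<open>Red subsets of regular size\<close>

lemma stable_pigeonhole:
  assumes st: "stable s" and B: "\<not> |B| <o s" and V: "|V| <o s" and f: "f ` B \<subseteq> V"
  shows "\<exists>v \<in> V. \<not> |{x \<in> B. f x = v}| <o s"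
proof (rule ccontr)
  assume "\<not> ?thesis"
  then have "|\<Union>v \<in> V. {x \<in> B. f x = v}| <o s"
    by (intro stable_UNION[OF st V]) blast
  moreover have "(\<Union>v \<in> V. {x \<in> B. f x = v}) = B"
    using f by blast
  ultimately show False
    using B by simp
qed

lemma stable_lists:
  fixes X :: "'b set"
  assumes st: "stable s" and unc: "natLeq <o s" and X: "|X| <o s"
  shows "|lists X| <o s"
proof -
  have nat: "|UNIV :: nat set| <o s"
    using unc card_of_nat ordIso_ordLess_trans by blast
  have "|{l \<in> lists X. length l = n}| <o s" for n
  proof (induction n)
    case 0
    have "{l \<in> lists X. length l = 0} = {[]}"
      by auto
    then show ?case
      using finite_iff_ordLess_natLeq[of "{[] :: 'b list}"] unc ordLess_transitive by auto
  next
    case (Suc n)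
    have "|Cons a ` {l \<in> lists X. length l = n}| <o s" for a
      by (rule ordLeq_ordLess_trans[OF card_of_image Suc])
    then have "|\<Union>a \<in> X. Cons a ` {l \<in> lists X. length l = n}| <o s"
      by (intro stable_UNION[OF st X])
    moreover have "{l \<in> lists X. length l = Suc n} \<subseteq> (\<Union>a \<in> X. Cons a ` {l \<in> lists X. length l = n})"
    proof
      fix l assume "l \<in> {l \<in> lists X. length l = Suc n}"
      then show "l \<in> (\<Union>a \<in> X. Cons a ` {l \<in> lists X. length l = n})"
        by (cases l) auto
    qed
    ultimately show ?case
      by (rule ordLeq_ordLess_trans[OF card_of_mono1, rotated])
  qed
  then have "|\<Union>n. {l \<in> lists X. length l = n}| <o s"
    by (intro stable_UNION[OF st nat])
  moreover have "lists X \<subseteq> (\<Union>n. {l \<in> lists X. length l = n})"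
    by blast
  ultimately show ?thesis
    by (rule ordLeq_ordLess_trans[OF card_of_mono1, rotated])
qed

text \<open>A form of Fodor's lemma: otherwise, closing under the fibers of the lists over a set yields a
  small set which contains every point of \<open>S\<close>.\<close>

lemma regressive_lists_large_fiber:
  fixes r :: "'a rel"
  assumes r: "Well_order r" and S: "S \<subseteq> Field r" and st: "stable |S|" and unc: "natLeq <o |S|"
    and f: "\<And>x. x \<in> S \<Longrightarrow> set (f x) \<subseteq> S \<inter> underS r x"
  shows "\<exists>l. \<not> |{x \<in> S. f x = l}| <o |S|"
proof (rule ccontr)
  assume "\<not> ?thesis"
  then have small: "|{x \<in> S. f x = l}| <o |S|" for l
    by blast
  have nat: "|UNIV :: nat set| <o |S|"
    using unc card_of_nat ordIso_ordLess_trans by blast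
  define X where "X = rec_nat ({} :: 'a set) (\<lambda>_ Y. Y \<union> (\<Union>l \<in> lists Y. {x \<in> S. f x = l}))"
  have X0: "X 0 = {}" and XS: "X (Suc n) = X n \<union> (\<Union>l \<in> lists (X n). {x \<in> S. f x = l})" for n
    by (simp_all add: X_def)
  have inf: "infinite S"
    using unc infinite_iff_natLeq_ordLeq ordLess_imp_ordLeq by blast
  have "|X n| <o |S|" for n
  proof (induction n)
    case 0
    show ?case
      using finite_iff_ordLess_natLeq[of "{} :: 'a set"] unc ordLess_transitive by (auto simp: X0)
  next
    case (Suc n)
    have "|\<Union>l \<in> lists (X n). {x \<in> S. f x = l}| <o |S|"
      by (intro stable_UNION[OF st stable_lists[OF st unc Suc]] small)
    then show ?case
      using card_of_Un_ordLess_infinite[OF inf Suc] by (simp only: XS)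
  qed
  then have U: "|\<Union>n. X n| <o |S|"
    by (intro stable_UNION[OF st nat])
  have mono: "X m \<subseteq> X n" if "m \<le> n" for m n
    using that by (induction rule: dec_induct) (auto simp: XS)
  have fin: "\<exists>n. set l \<subseteq> X n" if "set l \<subseteq> (\<Union>n. X n)" for l
    using that
  proof (induction l)
    case (Cons a l)
    then obtain m n where "a \<in> X m" "set l \<subseteq> X n"
      by auto
    then show ?case
      using mono[of m "max m n"] mono[of n "max m n"] by (intro exI[of _ "max m n"]) auto
  qed simp
  have closed: "x \<in> (\<Union>n. X n)" if x: "x \<in> S" "set (f x) \<subseteq> (\<Union>n. X n)" for x
  proof -
    obtain n where "set (f x) \<subseteq> X n"
      using fin[OF x(2)] by blast
    then have "x \<in> X (Suc n)"
      using that by (auto simp: XS)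
    then show ?thesis
      by blast
  qed
  have "wf (r - Id)"
    using r by (simp add: well_order_on_def)
  then have "x \<in> S \<longrightarrow> x \<in> (\<Union>n. X n)" for x
  proof (induction x rule: wf_induct_rule)
    case (less x)
    show ?case
    proof
      assume x: "x \<in> S"
      have "y \<in> (\<Union>n. X n)" if "y \<in> set (f x)" for y
        using less[of y] f[OF x] that by (auto simp: underS_def)
      then show "x \<in> (\<Union>n. X n)"
        using closed[OF x] by blast
    qed
  qed
  then have "|S| \<le>o |\<Union>n. X n|"
    by (intro card_of_mono1) blast
  then show False
    using U not_ordLess_ordLeq by blast
qed

lemma red_subset_if_no_green:
  assumes r: "Well_order r" and S: "S \<subseteq> Field r" and st: "stable |S|" and unc: "natLeq <o |S|"
    and ng: "no_green r c"
  shows "\<exists>S' \<subseteq> S. |S'| =o |S| \<and> (\<forall>x \<in> S'. \<forall>y \<in> S'. \<not> green c x y)"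
proof -
  have "\<exists>l. set l \<subseteq> S \<inter> underS r x \<and> (\<forall>z \<in> set l. green c z x) \<and>
      (\<forall>y \<in> S \<inter> underS r x. green c y x \<longrightarrow> \<not> (\<forall>z \<in> set l. green c y z))" if x: "x \<in> S" for x
  proof -
    let ?Q = "{l. set l \<subseteq> S \<inter> underS r x \<and> (\<forall>z \<in> set l. green c z x)}"
    have "wf (extend c (S \<inter> underS r x) x)"
      using wf_extend[OF r ng] x S by blast
    moreover have "[] \<in> ?Q"
      by simp
    ultimately obtain l where l: "l \<in> ?Q"
      and min: "\<And>k. (k, l) \<in> extend c (S \<inter> underS r x) x \<Longrightarrow> k \<notin> ?Q"
      by (rule wfE_min) blast
    have "\<not> (\<forall>z \<in> set l. green c y z)" if "y \<in> S \<inter> underS r x" "green c y x" for y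
      using min[of "y # l"] l that by (auto simp: extend_def)
    then show ?thesis
      using l by blast
  qed
  then have "\<forall>x \<in> S. \<exists>l. set l \<subseteq> S \<inter> underS r x \<and> (\<forall>z \<in> set l. green c z x) \<and>
      (\<forall>y \<in> S \<inter> underS r x. green c y x \<longrightarrow> \<not> (\<forall>z \<in> set l. green c y z))"
    by blast
  from bchoice[OF this] obtain f where f: "\<And>x. x \<in> S \<Longrightarrow> set (f x) \<subseteq> S \<inter> underS r x"
      "\<And>x z. x \<in> S \<Longrightarrow> z \<in> set (f x) \<Longrightarrow> green c z x"
      "\<And>x y. x \<in> S \<Longrightarrow> y \<in> S \<inter> underS r x \<Longrightarrow> green c y x \<Longrightarrow> \<not> (\<forall>z \<in> set (f x). green c y z)"
    by blast
  obtain l where l: "\<not> |{x \<in> S. f x = l}| <o |S|"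
    using regressive_lists_large_fiber[OF r S st unc f(1)] by blast
  define S' where "S' = {x \<in> S. f x = l}"
  have S': "S' \<subseteq> S"
    by (auto simp: S'_def)
  have "|S'| =o |S|"
    using l card_of_mono1[OF S'] by (simp add: S'_def ordLeq_iff_ordLess_or_ordIso)
  moreover have *: "\<not> green c y x" if "x \<in> S'" "y \<in> S'" "y \<in> underS r x" for x y
    using f(3)[of x y] f(2)[of y] that green_sym[of c y] by (auto simp: S'_def)
  have "\<not> green c x y" if xy: "x \<in> S'" "y \<in> S'" for x y
  proof -
    have "x \<in> Field r" "y \<in> Field r"
      using xy S' S by blast+
    then consider "x = y" | "x \<in> underS r y" | "y \<in> underS r x"
      using Well_order_underS_cases[OF r] by blast
    then show ?thesis
      using *[OF xy] *[OF xy(2,1)] green_sym[of c x y] by cases (auto simp: green_def)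
  qed
  ultimately show ?thesis
    using S' by blast
qed

subsection \<open>Ranks\<close>

lemma wfrec_image_exists:
  assumes "wf R"
  shows "\<exists>f. \<forall>a. f a = F a (f ` {b. (b, a) \<in> R})"
proof -
  define f where "f = wfrec R (\<lambda>g a. F a (g ` {b. (b, a) \<in> R}))"
  have "f a = F a (f ` {b. (b, a) \<in> R})" for a
  proof -
    have "cut f R a ` {b. (b, a) \<in> R} = f ` {b. (b, a) \<in> R}"
      by (auto simp: cut_apply image_iff)
    then show ?thesis
      unfolding f_def by (subst wfrec[OF assms]) (simp add: f_def)
  qed
  then show ?thesis
    by blast
qed

lemma not_cofinal_strict_bound:
  assumes r: "Card_order r" "infinite (Field r)" and T: "T \<subseteq> Field r" "\<not> cofinal T r"
  shows "\<exists>b \<in> Field r. \<forall>t \<in> T. t \<in> underS r b"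
proof -
  have wo: "Well_order r"
    using r by (simp add: card_order_on_well_order_on)
  then have lin: "trans r" "antisym r" "Total r" "Refl r"
    by (auto simp: well_order_on_def linear_order_on_def partial_order_on_def preorder_on_def)
  obtain a where a: "a \<in> Field r" "\<And>t. t \<in> T \<Longrightarrow> a = t \<or> (a, t) \<notin> r"
    using T(2) by (auto simp: cofinal_def)
  obtain b where b: "b \<in> Field r" "a \<noteq> b" "(a, b) \<in> r"
    using infinite_Card_order_limit[OF r a(1)] by blast
  have "(t, a) \<in> r" if "t \<in> T" for t
  proof -
    have "t \<in> Field r"
      using that T(1) by blast
    then consider "t = a" | "t \<in> underS r a" | "a \<in> underS r t"
      using Well_order_underS_cases[OF wo] a(1) by blast
    then show ?thesis
      using lin(4) a(1) a(2)[OF that] by cases (auto simp: underS_def refl_on_def)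
  qed
  then have "t \<in> underS r b" if "t \<in> T" for t
    using that b lin by (auto simp: underS_def dest: transD antisymD)
  then show ?thesis
    using b by blast
qed

lemma rank_in_cardSuc:
  fixes R :: "'a rel" and N :: "'n set"
  assumes wf: "wf R" and N: "infinite N" and children: "\<And>a. |{b. (b, a) \<in> R}| \<le>o |N|"
  shows "\<exists>f :: 'a \<Rightarrow> 'n set. (\<forall>a. f a \<in> Field (cardSuc |N| )) \<and>
           (\<forall>a b. (b, a) \<in> R \<longrightarrow> f b \<in> underS (cardSuc |N| ) (f a))"
proof -
  let ?W = "cardSuc |N|"
  have W: "Card_order ?W" "infinite (Field ?W)"
    using N cardSuc_finite[OF card_of_Card_order, of N]
      cardSuc_Card_order[OF card_of_Card_order, of N] Field_card_of[of N] by metis+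
  have reg: "regularCard ?W"
    using N infinite_cardSuc_regularCard[OF _ card_of_Card_order] by (simp add: Field_card_of)
  obtain f where f: "\<And>a. f a = (SOME v. v \<in> Field ?W \<and> (\<forall>u \<in> f ` {b. (b, a) \<in> R}. u \<in> underS ?W v))"
    using wfrec_image_exists[OF wf, of "\<lambda>_ U. SOME v. v \<in> Field ?W \<and> (\<forall>u \<in> U. u \<in> underS ?W v)"]
    by blast
  have "f a \<in> Field ?W \<and> (\<forall>b. (b, a) \<in> R \<longrightarrow> f b \<in> underS ?W (f a))" for a
    using wf
  proof (induction a rule: wf_induct_rule)
    case (less a)
    let ?T = "f ` {b. (b, a) \<in> R}"
    have "|?T| \<le>o |N|"
      using card_of_image children ordLeq_transitive by blast
    then have "|?T| <o ?W"
      using cardSuc_ordLeq_ordLess[OF card_of_Card_order card_of_Card_order] by blast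
    then have "\<not> |?T| =o ?W"
      using not_ordLess_ordIso by blast
    moreover have T: "?T \<subseteq> Field ?W"
      using less by blast
    ultimately have "\<not> cofinal ?T ?W"
      using reg unfolding regularCard_def by blast
    then have "\<exists>v. v \<in> Field ?W \<and> (\<forall>u \<in> ?T. u \<in> underS ?W v)"
      using not_cofinal_strict_bound[OF W T] by blast
    then show ?case
      using someI_ex[of "\<lambda>v. v \<in> Field ?W \<and> (\<forall>u \<in> ?T. u \<in> underS ?W v)"]
      unfolding f[of a, symmetric] by blast
  qed
  then show ?thesis
    by blast
qed

subsection \<open>The game\<close>

lemma Well_order_under_subset:
  assumes r: "Well_order r"
  shows "a \<in> under r b \<Longrightarrow> under r a \<subseteq> under r b" "a \<in> underS r b \<Longrightarrow> under r a \<subseteq> underS r b"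
proof -
  have t: "trans r" and as: "antisym r"
    using r by (auto simp: well_order_on_def linear_order_on_def partial_order_on_def preorder_on_def)
  show "a \<in> under r b \<Longrightarrow> under r a \<subseteq> under r b"
    using transD[OF t] by (auto simp: under_def)
  show "a \<in> underS r b \<Longrightarrow> under r a \<subseteq> underS r b"
    using transD[OF t] antisymD[OF as] by (auto simp: under_def underS_def)
qed

lemma Restr_underS_ordLess:
  assumes r: "Well_order r" and a: "a \<in> underS r b"
  shows "Restr r (underS r a) <o Restr r (underS r b)"
proof -
  have "underS r a \<subseteq> underS r b"
    using Well_order_under_subset(2)[OF r a] by (auto simp: under_def underS_def)
  moreover have "a \<notin> underS r a"
    by (simp add: underS_def)
  ultimately have "underS r a \<subset> underS r b"
    using a by blast
  then show ?thesis
    by (simp add: ofilter_subset_ordLess[OF r, symmetric] wo_rel.underS_ofilter wo_rel_def r)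
qed

lemma ordLess_imp_card_of_underS:
  assumes r: "Well_order r" and s: "s <o r"
  shows "\<exists>a \<in> Field r. |underS r a| =o |Field s|"
proof -
  have "Well_order s"
    using s by (auto simp: ordLess_def)
  then obtain a where a: "a \<in> Field r" "s =o Restr r (underS r a)"
    using ordLess_iff_ordIso_Restr[OF r] s by blast
  have "Refl r"
    using r by (auto simp: well_order_on_def linear_order_on_def partial_order_on_def preorder_on_def)
  then have "Field (Restr r (underS r a)) = underS r a"
    by (rule Refl_Field_Restr2) (auto simp: underS_def Field_def)
  then show ?thesis
    using a card_of_cong[OF a(2)] ordIso_symmetric by auto
qed

lemma ordLeq_card_of_if_underS:
  assumes r: "Well_order r" and X: "\<And>a. a \<in> Field r \<Longrightarrow> |underS r a| <o |X|"
  shows "r \<le>o |X|"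
proof (rule ccontr)
  assume "\<not> r \<le>o |X|"
  then have "|X| <o r"
    using not_ordLeq_iff_ordLess[OF card_of_Well_order r] by blast
  then obtain a where a: "a \<in> Field r" "|underS r a| =o |Field |X| |"
    using ordLess_imp_card_of_underS[OF r] by blast
  then have "|underS r a| =o |X|"
    by (simp only: Field_card_of)
  then show False
    using X[OF a(1)] not_ordLess_ordIso by blast
qed

locale red_blocks =
  fixes \<kappa> :: "'k rel" and lam :: "'l rel" and c :: "'l set \<Rightarrow> colour" and S N :: "'k \<Rightarrow> 'l set"
  assumes kappa: "Well_order \<kappa>" and lam: "Card_order lam"
    and no_green: "no_green lam c"
    and no_red: "\<And>X. X \<subseteq> Field lam \<Longrightarrow> |X| =o lam \<Longrightarrow> \<exists>x \<in> X. \<exists>y \<in> X. green c x y"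
    and S_Field: "\<And>\<zeta>. \<zeta> \<in> Field \<kappa> \<Longrightarrow> S \<zeta> \<subseteq> Field lam"
    and S_red: "\<And>\<zeta> x y. \<zeta> \<in> Field \<kappa> \<Longrightarrow> x \<in> S \<zeta> \<Longrightarrow> y \<in> S \<zeta> \<Longrightarrow> \<not> green c x y"
    and S_stable: "\<And>\<zeta>. \<zeta> \<in> Field \<kappa> \<Longrightarrow> stable |S \<zeta>|"
    and N_infinite: "\<And>\<zeta>. \<zeta> \<in> Field \<kappa> \<Longrightarrow> infinite (N \<zeta>)"
    and N_below_S: "\<And>\<zeta> x. \<zeta> \<in> Field \<kappa> \<Longrightarrow> x \<in> S \<zeta> \<Longrightarrow> N \<zeta> \<subseteq> underS lam x"
    and S_subset_N: "\<And>\<xi> \<zeta>. \<zeta> \<in> Field \<kappa> \<Longrightarrow> \<xi> \<in> underS \<kappa> \<zeta> \<Longrightarrow> S \<xi> \<subseteq> N \<zeta>"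
    and cardSuc_N: "\<And>\<zeta>. \<zeta> \<in> Field \<kappa> \<Longrightarrow> cardSuc |N \<zeta>| <o |S \<zeta>|"
    and Pow_kappa: "\<And>\<zeta>. \<zeta> \<in> Field \<kappa> \<Longrightarrow> |Pow (Field \<kappa>)| \<le>o |N \<zeta>|"
    and N_cofinal: "\<And>a. a \<in> Field lam \<Longrightarrow>
      \<exists>\<alpha> \<in> Field \<kappa>. \<forall>\<zeta> \<in> aboveS \<kappa> \<alpha>. |underS lam a| \<le>o |N \<zeta>|"
begin

definition large :: "'k \<Rightarrow> 'l set \<Rightarrow> bool" where
  "large \<zeta> B \<longleftrightarrow> B \<subseteq> S \<zeta> \<and> \<not> |B| <o |S \<zeta>|"

lemma N_less_S: "\<zeta> \<in> Field \<kappa> \<Longrightarrow> |N \<zeta>| <o |S \<zeta>|"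
  using cardSuc_N cardSuc_greater[OF card_of_Card_order] ordLess_transitive by blast

lemma S_infinite: "\<zeta> \<in> Field \<kappa> \<Longrightarrow> infinite (S \<zeta>)"
  using N_less_S N_infinite card_of_ordLeq_infinite ordLess_imp_ordLeq by blast

lemma large_not_empty: "\<zeta> \<in> Field \<kappa> \<Longrightarrow> large \<zeta> B \<Longrightarrow> B \<noteq> {}"
  using N_less_S card_of_empty ordLeq_ordLess_trans unfolding large_def by blast

lemma large_diff:
  assumes \<zeta>: "\<zeta> \<in> Field \<kappa>" and B: "large \<zeta> B" and X: "|X| <o |S \<zeta>|"
  shows "large \<zeta> (B - X)"
proof -
  have "\<not> |B - X| <o |S \<zeta>|"
  proof
    assume "|B - X| <o |S \<zeta>|"
    then have "|(B - X) \<union> X| <o |S \<zeta>|"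
      using X card_of_Un_ordLess_infinite[OF S_infinite[OF \<zeta>]] by blast
    moreover have "|B| \<le>o |(B - X) \<union> X|"
      by (rule card_of_mono1) blast
    ultimately have "|B| <o |S \<zeta>|"
      using ordLeq_ordLess_trans by blast
    then show False
      using B by (simp add: large_def)
  qed
  then show ?thesis
    using B by (auto simp: large_def)
qed

lemma large_pigeonhole:
  assumes \<zeta>: "\<zeta> \<in> Field \<kappa>" and B: "large \<zeta> B" and V: "|V| <o |S \<zeta>|" and f: "f ` B \<subseteq> V"
  shows "\<exists>v \<in> V. large \<zeta> {x \<in> B. f x = v}"
proof -
  obtain v where "v \<in> V" "\<not> |{x \<in> B. f x = v}| <o |S \<zeta>|"
    using stable_pigeonhole[OF S_stable[OF \<zeta>] _ V f] B by (auto simp: large_def)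
  then show ?thesis
    using B by (auto simp: large_def)
qed

text \<open>If no such \<open>y\<close> existed, then the points of a large part of each block would have the same
  \<open>E\<close>-large set of blocks in which they have few green neighbours, as \<open>2\<^sup>\<kappa>\<close> is small; on the diagonal
  intersection of these sets one could thin out the blocks to a red set of size \<open>lam\<close>.\<close>

lemma exists_positive_green:
  assumes E: "normal_filter \<kappa> E" and A: "A \<in> E" and B: "\<And>\<zeta>. \<zeta> \<in> A \<Longrightarrow> large \<zeta> (B \<zeta>)"
  shows "\<exists>\<xi> \<in> A. \<exists>y \<in> B \<xi>. {\<zeta> \<in> A \<inter> aboveS \<kappa> \<xi>. large \<zeta> {x \<in> B \<zeta>. green c x y}} \<in> positive_sets \<kappa> E"
proof (rule ccontr)
  assume neg: "\<not> ?thesis"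
  have F: "filter_on (Field \<kappa>) E"
    and above: "\<And>\<alpha>. \<alpha> \<in> Field \<kappa> \<Longrightarrow> aboveS \<kappa> \<alpha> \<in> E"
    and diag: "\<And>X. (\<And>\<xi>. \<xi> \<in> Field \<kappa> \<Longrightarrow> X \<xi> \<in> E) \<Longrightarrow> diag_Inter \<kappa> X \<in> E"
    using E by (auto simp: normal_filter_def)
  have FD: "\<And>X. X \<in> E \<Longrightarrow> X \<subseteq> Field \<kappa>" "Field \<kappa> \<in> E" "{} \<notin> E"
    "\<And>X Y. X \<in> E \<Longrightarrow> Y \<in> E \<Longrightarrow> X \<inter> Y \<in> E"
    "\<And>X Y. X \<in> E \<Longrightarrow> X \<subseteq> Y \<Longrightarrow> Y \<subseteq> Field \<kappa> \<Longrightarrow> Y \<in> E"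
    using F by (auto simp: filter_on_def)
  have AF: "\<zeta> \<in> Field \<kappa>" if "\<zeta> \<in> A" for \<zeta>
    using FD(1)[OF A] that by blast
  define K where "K y = {\<zeta> \<in> Field \<kappa>. \<zeta> \<in> A \<longrightarrow> \<not> large \<zeta> {x \<in> B \<zeta>. green c x y}}" for y
  have K: "K y \<in> E" if "\<xi> \<in> A" "y \<in> B \<xi>" for \<xi> y
  proof -
    let ?P = "{\<zeta> \<in> A \<inter> aboveS \<kappa> \<xi>. large \<zeta> {x \<in> B \<zeta>. green c x y}}"
    have "?P \<notin> positive_sets \<kappa> E"
      using neg that by blast
    then have "Field \<kappa> - ?P \<in> E"
      using AF by (auto simp: positive_sets_def)
    then have "(Field \<kappa> - ?P) \<inter> aboveS \<kappa> \<xi> \<in> E"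
      using FD(4) above AF that(1) by blast
    then show ?thesis
      by (rule FD(5)) (auto simp: K_def)
  qed
  have "\<exists>k. large \<xi> {y \<in> B \<xi>. K y = k}" if \<xi>: "\<xi> \<in> A" for \<xi>
  proof -
    have "|Pow (Field \<kappa>)| <o |S \<xi>|"
      using Pow_kappa N_less_S AF[OF \<xi>] ordLeq_ordLess_trans by blast
    moreover have "K ` B \<xi> \<subseteq> Pow (Field \<kappa>)"
      by (auto simp: K_def)
    ultimately show ?thesis
      using large_pigeonhole[OF AF[OF \<xi>] B[OF \<xi>]] by blast
  qed
  then have "\<forall>\<xi> \<in> A. \<exists>k. large \<xi> {y \<in> B \<xi>. K y = k}"
    by blast
  from bchoice[OF this] obtain k where k: "\<And>\<xi>. \<xi> \<in> A \<Longrightarrow> large \<xi> {y \<in> B \<xi>. K y = k \<xi>}"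
    by blast
  define B' where "B' \<xi> = {y \<in> B \<xi>. K y = k \<xi>}" for \<xi>
  have B': "large \<xi> (B' \<xi>)" "B' \<xi> \<subseteq> S \<xi>" if "\<xi> \<in> A" for \<xi>
    using k[OF that] by (auto simp: B'_def large_def)
  have kE: "k \<xi> \<in> E" if \<xi>: "\<xi> \<in> A" for \<xi>
  proof -
    have "B' \<xi> \<noteq> {}"
      using large_not_empty[OF AF[OF \<xi>] B'(1)[OF \<xi>]] .
    then show ?thesis
      using K[OF \<xi>] unfolding B'_def by force
  qed
  define Y where "Y = diag_Inter \<kappa> (\<lambda>\<xi>. if \<xi> \<in> A then k \<xi> else Field \<kappa>) \<inter> A"
  have YE: "Y \<in> E"
    unfolding Y_def by (intro FD(4) diag A) (use kE FD(2) in auto)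
  have YA: "\<zeta> \<in> A" if "\<zeta> \<in> Y" for \<zeta>
    using that by (simp add: Y_def)
  have few: "\<not> large \<zeta> {x \<in> B \<zeta>. green c x y}"
    if "\<zeta> \<in> Y" "\<xi> \<in> Y" "\<xi> \<in> underS \<kappa> \<zeta>" "y \<in> B' \<xi>" for \<zeta> \<xi> y
  proof -
    have "\<zeta> \<in> (if \<xi> \<in> A then k \<xi> else Field \<kappa>)"
      using that(1,3) unfolding Y_def diag_Inter_def by blast
    then have "\<zeta> \<in> k \<xi>"
      using YA[OF that(2)] by simp
    then show ?thesis
      using that YA[of \<zeta>] by (auto simp: B'_def K_def)
  qed
  define bad where "bad \<zeta> = {y. \<exists>\<xi> \<in> Y \<inter> underS \<kappa> \<zeta>. y \<in> B' \<xi>}" for \<zeta>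
  define C where "C \<zeta> = B' \<zeta> - (\<Union>y \<in> bad \<zeta>. {x \<in> B \<zeta>. green c x y})" for \<zeta>
  have C: "large \<zeta> (C \<zeta>)" if \<zeta>: "\<zeta> \<in> Y" for \<zeta>
    unfolding C_def
  proof (rule large_diff)
    show \<zeta>F: "\<zeta> \<in> Field \<kappa>" and "large \<zeta> (B' \<zeta>)"
      using \<zeta> YA AF B' by auto
    have "bad \<zeta> \<subseteq> N \<zeta>"
      using B'(2) YA S_subset_N[OF \<zeta>F] by (fastforce simp: bad_def)
    then have "|bad \<zeta>| <o |S \<zeta>|"
      using card_of_mono1 N_less_S[OF \<zeta>F] ordLeq_ordLess_trans by blast
    then show "|\<Union>y \<in> bad \<zeta>. {x \<in> B \<zeta>. green c x y}| <o |S \<zeta>|"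
    proof (rule stable_UNION[OF S_stable[OF \<zeta>F]])
      fix y assume "y \<in> bad \<zeta>"
      then have "\<not> large \<zeta> {x \<in> B \<zeta>. green c x y}"
        using few \<zeta> by (auto simp: bad_def)
      then show "|{x \<in> B \<zeta>. green c x y}| <o |S \<zeta>|"
        using B[OF YA[OF \<zeta>]] by (auto simp: large_def)
    qed
  qed
  have CB: "C \<zeta> \<subseteq> B' \<zeta>" "C \<zeta> \<subseteq> B \<zeta>" "\<zeta> \<in> Y \<Longrightarrow> C \<zeta> \<subseteq> S \<zeta>" for \<zeta>
    using B'(2) YA by (auto simp: C_def B'_def)
  have lt: "\<not> green c x y" if "\<zeta> \<in> Y" "\<xi> \<in> Y" "\<xi> \<in> underS \<kappa> \<zeta>" "x \<in> C \<zeta>" "y \<in> C \<xi>" for \<zeta> \<xi> x y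
  proof
    assume "green c x y"
    moreover have "y \<in> bad \<zeta>"
      using that CB(1) by (auto simp: bad_def)
    moreover have "x \<in> B \<zeta>"
      using that CB(2) by blast
    ultimately have "x \<notin> C \<zeta>"
      unfolding C_def by blast
    then show False
      using that by blast
  qed
  define X where "X = (\<Union>\<zeta> \<in> Y. C \<zeta>)"
  have XF: "X \<subseteq> Field lam"
    using CB(3) S_Field AF YA unfolding X_def by blast
  have red: "\<not> green c x y" if xy: "x \<in> X" "y \<in> X" for x y
  proof -
    obtain \<zeta> \<xi> where z: "\<zeta> \<in> Y" "\<xi> \<in> Y" "x \<in> C \<zeta>" "y \<in> C \<xi>"
      using xy by (auto simp: X_def)
    have zF: "\<zeta> \<in> Field \<kappa>" "\<xi> \<in> Field \<kappa>"
      using z YA AF by blast+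
    then consider "\<zeta> = \<xi>" | "\<zeta> \<in> underS \<kappa> \<xi>" | "\<xi> \<in> underS \<kappa> \<zeta>"
      using Well_order_underS_cases[OF kappa] by blast
    then show ?thesis
    proof cases
      case 1
      then show ?thesis
        using S_red[OF zF(1)] CB(3) z by blast
    next
      case 2
      then show ?thesis
        using lt z green_sym[of c x y] by blast
    next
      case 3
      then show ?thesis
        using lt z by blast
    qed
  qed
  have below: "|underS lam a| <o |X|" if a: "a \<in> Field lam" for a
  proof -
    obtain \<alpha> where \<alpha>: "\<alpha> \<in> Field \<kappa>" "\<And>\<zeta>. \<zeta> \<in> aboveS \<kappa> \<alpha> \<Longrightarrow> |underS lam a| \<le>o |N \<zeta>|"
      using N_cofinal[OF a] by blast
    have "Y \<inter> aboveS \<kappa> \<alpha> \<noteq> {}"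
      using FD(3,4) YE above[OF \<alpha>(1)] by metis
    then obtain \<zeta> where \<zeta>: "\<zeta> \<in> Y" "\<zeta> \<in> aboveS \<kappa> \<alpha>"
      by blast
    have "|underS lam a| <o |S \<zeta>|"
      using \<alpha>(2)[OF \<zeta>(2)] N_less_S AF YA \<zeta>(1) ordLeq_ordLess_trans by blast
    also have "|S \<zeta>| \<le>o |C \<zeta>|"
      using C[OF \<zeta>(1)] not_ordLess_iff_ordLeq[OF card_of_Well_order card_of_Well_order]
      unfolding large_def by blast
    also have "|C \<zeta>| \<le>o |X|"
      by (rule card_of_mono1) (use \<zeta> in \<open>auto simp: X_def\<close>)
    finally show ?thesis .
  qed
  have "lam \<le>o |X|"
    using ordLeq_card_of_if_underS[OF _ below] lam by (simp add: card_order_on_well_order_on)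
  moreover have "|X| \<le>o lam"
    using card_of_mono1[OF XF] card_of_Field_ordIso[OF lam] ordLeq_ordIso_trans by blast
  ultimately have "|X| =o lam"
    by (simp add: ordIso_iff_ordLeq)
  then show False
    using no_red[OF XF] red by blast
qed

lemma exists_rank:
  "\<exists>\<rho> :: 'k \<Rightarrow> 'l \<Rightarrow> 'l list \<Rightarrow> 'l set. \<forall>\<zeta> \<in> Field \<kappa>. \<forall>x \<in> S \<zeta>.
     (\<forall>l. \<rho> \<zeta> x l \<in> Field (cardSuc |N \<zeta>| )) \<and>
     (\<forall>l k. (k, l) \<in> extend c (N \<zeta>) x \<longrightarrow> \<rho> \<zeta> x k \<in> underS (cardSuc |N \<zeta>| ) (\<rho> \<zeta> x l))"
proof -
  define good where "good \<zeta> x \<rho> \<longleftrightarrow> (\<forall>l. \<rho> l \<in> Field (cardSuc |N \<zeta>| )) \<and>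
     (\<forall>l k. (k, l) \<in> extend c (N \<zeta>) x \<longrightarrow> \<rho> k \<in> underS (cardSuc |N \<zeta>| ) (\<rho> l))"
    for \<zeta> x and \<rho> :: "'l list \<Rightarrow> 'l set"
  have "\<exists>\<rho>. good \<zeta> x \<rho>" if \<zeta>: "\<zeta> \<in> Field \<kappa>" and x: "x \<in> S \<zeta>" for \<zeta> x
    unfolding good_def
  proof (rule rank_in_cardSuc)
    have "x \<in> Field lam"
      using S_Field \<zeta> x by blast
    then show "wf (extend c (N \<zeta>) x)"
      using wf_extend[OF _ no_green _ N_below_S[OF \<zeta> x]] lam by (simp add: card_order_on_well_order_on)
    show "infinite (N \<zeta>)"
      using N_infinite \<zeta> .
    fix l
    have "{k. (k, l) \<in> extend c (N \<zeta>) x} \<subseteq> (\<lambda>y. y # l) ` N \<zeta>"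
      by (auto simp: extend_def)
    then show "|{k. (k, l) \<in> extend c (N \<zeta>) x}| \<le>o |N \<zeta>|"
      using card_of_mono1 card_of_image ordLeq_transitive by blast
  qed
  then have "\<forall>\<zeta> x. \<exists>\<rho>. \<zeta> \<in> Field \<kappa> \<longrightarrow> x \<in> S \<zeta> \<longrightarrow> good \<zeta> x \<rho>"
    by blast
  then obtain \<rho> where "\<forall>\<zeta> x. \<zeta> \<in> Field \<kappa> \<longrightarrow> x \<in> S \<zeta> \<longrightarrow> good \<zeta> x (\<rho> \<zeta> x)"
    by metis
  then show ?thesis
    unfolding good_def by blast
qed

definition rank :: "'k \<Rightarrow> 'l \<Rightarrow> 'l list \<Rightarrow> 'l set" where
  "rank = (SOME \<rho>. \<forall>\<zeta> \<in> Field \<kappa>. \<forall>x \<in> S \<zeta>.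
     (\<forall>l. \<rho> \<zeta> x l \<in> Field (cardSuc |N \<zeta>| )) \<and>
     (\<forall>l k. (k, l) \<in> extend c (N \<zeta>) x \<longrightarrow> \<rho> \<zeta> x k \<in> underS (cardSuc |N \<zeta>| ) (\<rho> \<zeta> x l)))"

lemma rank:
  assumes "\<zeta> \<in> Field \<kappa>" "x \<in> S \<zeta>"
  shows "rank \<zeta> x l \<in> Field (cardSuc |N \<zeta>| )"
    and "(k, l) \<in> extend c (N \<zeta>) x \<Longrightarrow> rank \<zeta> x k \<in> underS (cardSuc |N \<zeta>| ) (rank \<zeta> x l)"
  using someI_ex[OF exists_rank, folded rank_def] assms by blast+

definition ordinal :: "'k \<Rightarrow> 'l set \<Rightarrow> 'l set rel" where
  "ordinal \<zeta> v = Restr (cardSuc |N \<zeta>| ) (underS (cardSuc |N \<zeta>| ) v)"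

lemma Well_order_cardSuc_N: "Well_order (cardSuc |N \<zeta>| )"
  by (rule cardSuc_Well_order[OF card_of_Card_order])

lemma ord_valued_ordinal: "ord_valued \<kappa> (\<lambda>\<zeta>. ordinal \<zeta> (v \<zeta>))"
  unfolding ord_valued_def ordinal_def using Well_order_Restr[OF Well_order_cardSuc_N] by blast

text \<open>There are only \<open>|N \<zeta>|\<^sup>+ < |S \<zeta>|\<close> ranks.\<close>

lemma constant_rank:
  assumes \<zeta>: "\<zeta> \<in> Field \<kappa>" and B: "large \<zeta> B"
  shows "\<exists>v. large \<zeta> {x \<in> B. rank \<zeta> x l = v}"
proof -
  have "|Field (cardSuc |N \<zeta>| )| =o cardSuc |N \<zeta>|"
    by (rule card_of_Field_ordIso[OF cardSuc_Card_order[OF card_of_Card_order]])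
  then have "|Field (cardSuc |N \<zeta>| )| <o |S \<zeta>|"
    using cardSuc_N[OF \<zeta>] ordIso_ordLess_trans by blast
  moreover have "(\<lambda>x. rank \<zeta> x l) ` B \<subseteq> Field (cardSuc |N \<zeta>| )"
    using rank(1)[OF \<zeta>] B by (auto simp: large_def)
  ultimately show ?thesis
    using large_pigeonhole[OF \<zeta> B] by blast
qed

text \<open>Player II survives by maintaining a finite green set \<open>l\<close> and, in each block of the current
  positive set, a large set of points which are green to \<open>l\<close> and have the same rank over \<open>l\<close>.\<close>

lemma won_impossible:
  fixes h :: "'k \<Rightarrow> 'l set rel"
  assumes "won \<kappa> E A h"
    and "\<And>\<zeta>. \<zeta> \<in> A \<Longrightarrow> \<zeta> \<in> Field \<kappa> \<Longrightarrow> large \<zeta> (B \<zeta>) \<and> h \<zeta> = ordinal \<zeta> (v \<zeta>) \<and>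
      (\<forall>x \<in> B \<zeta>. rank \<zeta> x l = v \<zeta> \<and> (\<forall>z \<in> set l. green c x z))"
  shows False
  using assms
proof (induction arbitrary: B v l rule: won.induct)
  case (1 E A E' h)
  have E': "normal_filter \<kappa> E'" "A \<in> E'"
    using 1(1) by (auto simp: legal_I_def)
  then have "A \<subseteq> Field \<kappa>"
    by (auto simp: normal_filter_def filter_on_def)
  then have A: "\<zeta> \<in> Field \<kappa>" "large \<zeta> (B \<zeta>)" "h \<zeta> = ordinal \<zeta> (v \<zeta>)" if "\<zeta> \<in> A" for \<zeta>
    using "1.prems"[of \<zeta>] that by auto
  have Bx: "rank \<zeta> x l = v \<zeta>" "\<forall>z \<in> set l. green c x z" "x \<in> S \<zeta>" if "\<zeta> \<in> A" "x \<in> B \<zeta>" for \<zeta> x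
    using "1.prems"[of \<zeta>] A[of \<zeta>] that by (auto simp: large_def)
  define A' where "A' \<xi> y = {\<zeta> \<in> A \<inter> aboveS \<kappa> \<xi>. large \<zeta> {x \<in> B \<zeta>. green c x y}}" for \<xi> y
  obtain \<xi> y where y: "\<xi> \<in> A" "y \<in> B \<xi>" "A' \<xi> y \<in> positive_sets \<kappa> E'"
    using exists_positive_green[OF E' A(2)] unfolding A'_def by blast
  have A': "\<zeta> \<in> A" "\<zeta> \<in> Field \<kappa>" "\<xi> \<in> underS \<kappa> \<zeta>" "large \<zeta> {x \<in> B \<zeta>. green c x y}" if "\<zeta> \<in> A' \<xi> y" for \<zeta>
    using that A(1) by (auto simp: A'_def aboveS_def underS_def)
  have "\<forall>\<zeta> \<in> A' \<xi> y. \<exists>v'. large \<zeta> {x \<in> {x \<in> B \<zeta>. green c x y}. rank \<zeta> x (y # l) = v'}"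
    using constant_rank A' by blast
  from bchoice[OF this] obtain v' where
    v': "\<And>\<zeta>. \<zeta> \<in> A' \<xi> y \<Longrightarrow> large \<zeta> {x \<in> {x \<in> B \<zeta>. green c x y}. rank \<zeta> x (y # l) = v' \<zeta>}"
    by blast
  define B' where "B' \<zeta> = {x \<in> {x \<in> B \<zeta>. green c x y}. rank \<zeta> x (y # l) = v' \<zeta>}" for \<zeta>
  define h' where "h' \<zeta> = ordinal \<zeta> (v' \<zeta>)" for \<zeta>
  have less: "h' \<zeta> <o h \<zeta>" if \<zeta>: "\<zeta> \<in> A' \<xi> y" for \<zeta>
  proof -
    have "B' \<zeta> \<noteq> {}"
      unfolding B'_def using large_not_empty[OF A'(2)[OF \<zeta>] v'[OF \<zeta>]] .
    then obtain x where x: "x \<in> B \<zeta>" "green c x y" "rank \<zeta> x (y # l) = v' \<zeta>"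
      by (auto simp: B'_def)
    have "y \<in> N \<zeta>"
      using S_subset_N[OF A'(2,3)[OF \<zeta>]] Bx(3)[OF y(1,2)] by blast
    then have "(y # l, l) \<in> extend c (N \<zeta>) x"
      using Bx(2)[OF y(1,2)] x(2) green_sym[of c x y] by (auto simp: extend_def)
    then have "v' \<zeta> \<in> underS (cardSuc |N \<zeta>| ) (v \<zeta>)"
      using rank(2)[OF A'(2)[OF \<zeta>] Bx(3)[OF A'(1)[OF \<zeta>] x(1)]] x(3) Bx(1)[OF A'(1)[OF \<zeta>] x(1)]
      by metis
    then show ?thesis
      using Restr_underS_ordLess[OF Well_order_cardSuc_N] A(3)[OF A'(1)[OF \<zeta>]]
      by (simp add: h'_def ordinal_def)
  qed
  have "less_mod \<kappa> (normal_filter_gen \<kappa> (E' \<union> {A' \<xi> y})) h' h"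
    unfolding less_mod_def normal_filter_gen_def
  proof clarify
    fix F assume F: "normal_filter \<kappa> F" "E' \<union> {A' \<xi> y} \<subseteq> F"
    then have "A' \<xi> y \<in> F"
      by blast
    moreover have "A' \<xi> y \<subseteq> {\<gamma> \<in> Field \<kappa>. h' \<gamma> <o h \<gamma>}"
      using less A'(2) by blast
    ultimately show "{\<gamma> \<in> Field \<kappa>. h' \<gamma> <o h \<gamma>} \<in> F"
      using F(1) unfolding normal_filter_def filter_on_def by blast
  qed
  then have "legal_II \<kappa> E' h (A' \<xi> y) h'"
    using y(3) ord_valued_ordinal[of v'] by (simp add: legal_II_def h'_def[abs_def])
  then show False
  proof (rule "1.IH")
    fix \<zeta> assume \<zeta>: "\<zeta> \<in> A' \<xi> y"
    show "large \<zeta> (B' \<zeta>) \<and> h' \<zeta> = ordinal \<zeta> (v' \<zeta>) \<and>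
      (\<forall>x \<in> B' \<zeta>. rank \<zeta> x (y # l) = v' \<zeta> \<and> (\<forall>z \<in> set (y # l). green c x z))"
      using v'[OF \<zeta>] Bx(2)[OF A'(1)[OF \<zeta>]] by (auto simp: B'_def h'_def)
  qed
qed

lemma no_nice_filter:
  assumes D: "normal_filter \<kappa> D" and nice: "nice \<kappa> D" and inf: "infinite (Field \<kappa>)"
  shows False
proof -
  have "large \<zeta> (S \<zeta>)" for \<zeta>
    by (simp add: large_def ordLess_irreflexive)
  then have "\<forall>\<zeta> \<in> Field \<kappa>. \<exists>v. large \<zeta> {x \<in> S \<zeta>. rank \<zeta> x [] = v}"
    using constant_rank by blast
  from bchoice[OF this] obtain v where
    v: "\<And>\<zeta>. \<zeta> \<in> Field \<kappa> \<Longrightarrow> large \<zeta> {x \<in> S \<zeta>. rank \<zeta> x [] = v \<zeta>}"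
    by blast
  obtain \<sigma> where "winning_I \<kappa> D (\<lambda>\<zeta>. ordinal \<zeta> (v \<zeta>)) \<sigma>"
    using nice_all_ordinals[OF inf nice ord_valued_ordinal] by blast
  moreover have "Field \<kappa> \<in> positive_sets \<kappa> D"
    using D by (simp add: positive_sets_def normal_filter_def filter_on_def)
  ultimately have "won \<kappa> D (Field \<kappa>) (\<lambda>\<zeta>. ordinal \<zeta> (v \<zeta>))"
    by (rule winning_I_imp_won)
  then show False
    by (rule won_impossible[where B = "\<lambda>\<zeta>. {x \<in> S \<zeta>. rank \<zeta> x [] = v \<zeta>}" and v = v and l = "[]"])
      (use v in auto)
qed

end

subsection \<open>Splitting a singular cardinal into blocks\<close>

lemma cardSuc_ordLess_singular:
  assumes lam: "Card_order lam" and cof: "has_cofinality lam \<kappa>" and sing: "\<kappa> <o lam"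
    and s: "Card_order s" "infinite (Field s)" "s <o lam"
  shows "cardSuc s <o lam"
proof -
  have "cardSuc s \<le>o lam"
    using s lam cardSuc_ordLess_ordLeq by blast
  moreover have "\<not> cardSuc s =o lam"
  proof
    assume iso: "cardSuc s =o lam"
    have "Cinfinite (cardSuc s)"
      using s Cinfinite_cardSuc by (auto simp: cinfinite_def)
    moreover have "regularCard (cardSuc s)"
      using infinite_cardSuc_regularCard[OF s(2,1)] .
    ultimately have "regularCard lam"
      using iso regularCard_ordIso by blast
    moreover obtain A where A: "A \<subseteq> Field lam" "cofinal A lam" "|A| =o \<kappa>"
      using cof by (auto simp: has_cofinality_def)
    ultimately have "|A| =o lam"
      by (auto simp: regularCard_def)
    then have "\<kappa> =o lam"
      using A(3) ordIso_symmetric ordIso_transitive by blast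
    then show False
      using sing not_ordLess_ordIso by blast
  qed
  ultimately show ?thesis
    using ordLeq_iff_ordLess_or_ordIso by blast
qed

lemma exists_red_block:
  assumes lam: "Card_order lam" "infinite (Field lam)" and ng: "no_green lam c"
    and limit: "\<And>U :: 'l set. infinite U \<Longrightarrow> |U| <o lam \<Longrightarrow> cardSuc (cardSuc |U| ) <o lam"
    and a: "a \<in> Field lam" "infinite (under lam a)"
  shows "\<exists>S d. d \<in> Field (lam :: 'l rel) \<and> S \<subseteq> underS lam d \<and> (\<forall>x \<in> S. under lam a \<subseteq> underS lam x) \<and>
           |S| =o cardSuc (cardSuc |under lam a| ) \<and> (\<forall>x \<in> S. \<forall>y \<in> S. \<not> green c x y)"
proof -
  let ?U = "under lam a" and ?M = "cardSuc (cardSuc |under lam a| )"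
  have wo: "Well_order lam"
    using lam by (simp add: card_order_on_well_order_on)
  obtain b where b: "b \<in> Field lam" "a \<noteq> b" "(a, b) \<in> lam"
    using infinite_Card_order_limit[OF lam a(1)] by blast
  then have "?U \<subseteq> underS lam b"
    using Well_order_under_subset(2)[OF wo, of a b] by (simp add: underS_def)
  then have U: "|?U| <o lam"
    using card_of_mono1 card_of_underS[OF lam(1) b(1)] ordLeq_ordLess_trans by blast
  have c1: "Cinfinite |?U|"
    using a(2) card_of_Card_order[of ?U] by (simp add: cinfinite_def Field_card_of)
  then have c2: "Cinfinite (cardSuc |?U| )" and c3: "Cinfinite ?M"
    by (simp_all only: Cinfinite_cardSuc)
  have M: "Card_order ?M" "infinite (Field ?M)"
    using c3 by (auto simp: cinfinite_def)
  have stM: "stable ?M"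
    using regularCard_stable[OF M] regularCard_cardSuc[OF c2] by blast
  have UM: "|?U| <o ?M"
    using ordLess_transitive[OF cardSuc_greater cardSuc_greater] c1 c2 by blast
  obtain d where d: "d \<in> Field lam" "|underS lam d| =o |Field ?M|"
    using ordLess_imp_card_of_underS[OF wo limit[OF a(2) U]] by blast
  have dM: "|underS lam d| =o ?M"
    using d(2) card_of_Field_ordIso[OF M(1)] ordIso_transitive by blast
  define T where "T = underS lam d - ?U"
  have "\<not> |T| <o ?M"
  proof
    assume "|T| <o ?M"
    then have "|T \<union> ?U| <o ?M"
      using UM card_of_Un_ordLess_infinite_Field[OF M(2,1)] by blast
    moreover have "|underS lam d| \<le>o |T \<union> ?U|"
      by (rule card_of_mono1) (auto simp: T_def)
    ultimately have "|underS lam d| <o ?M"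
      using ordLeq_ordLess_trans by blast
    then show False
      using dM not_ordLess_ordIso by blast
  qed
  moreover have "|T| \<le>o ?M"
    using card_of_mono1[of T "underS lam d"] dM ordLeq_ordIso_trans by (auto simp: T_def)
  ultimately have TM: "|T| =o ?M"
    using ordLeq_iff_ordLess_or_ordIso by blast
  have TF: "T \<subseteq> Field lam"
    by (auto simp: T_def underS_def Field_def)
  have "stable |T|"
    using stable_ordIso1[OF stM TM] .
  moreover have "natLeq <o |T|"
  proof -
    have "natLeq <o ?M"
      using natLeq_ordLeq_cinfinite[OF c1] UM ordLeq_ordLess_trans by blast
    then show ?thesis
      using TM ordIso_symmetric ordLess_ordIso_trans by blast
  qed
  ultimately obtain S where S: "S \<subseteq> T" "|S| =o |T|" "\<forall>x \<in> S. \<forall>y \<in> S. \<not> green c x y"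
    using red_subset_if_no_green[OF wo TF _ _ ng] by blast
  have "under lam a \<subseteq> underS lam x" if "x \<in> T" for x
  proof -
    have x: "x \<in> Field lam" "x \<notin> ?U"
      using that TF by (auto simp: T_def)
    have "(a, a) \<in> lam"
      using wo a(1) by (auto simp: well_order_on_def linear_order_on_def partial_order_on_def
          preorder_on_def refl_on_def)
    then have "a \<in> underS lam x"
      using Well_order_underS_cases[OF wo a(1) x(1)] x(2) by (auto simp: under_def underS_def)
    then show ?thesis
      by (rule Well_order_under_subset(2)[OF wo])
  qed
  then show ?thesis
    using d(1) S ordIso_transitive[OF S(2) TM]
    by (intro exI[of _ S] exI[of _ d]) (auto simp: T_def)
qed

lemma exists_cofinal_sequence:
  fixes \<kappa> :: "'k rel" and lam :: "'l rel" and d :: "'l \<Rightarrow> 'l"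
  assumes \<kappa>: "Card_order \<kappa>" "infinite (Field \<kappa>)" and lam: "Card_order lam" "infinite (Field lam)"
    and cof: "has_cofinality lam \<kappa>" and b: "b \<in> Field lam"
    and d: "\<And>a. a \<in> Field lam \<Longrightarrow> b \<in> underS lam a \<Longrightarrow> d a \<in> Field lam"
  shows "\<exists>f. (\<forall>\<zeta> \<in> Field \<kappa>. f \<zeta> \<in> Field lam \<and> b \<in> underS lam (f \<zeta>) \<and>
             (\<forall>\<xi> \<in> underS \<kappa> \<zeta>. d (f \<xi>) \<in> underS lam (f \<zeta>))) \<and>
           (\<forall>a \<in> Field lam. \<exists>\<zeta> \<in> Field \<kappa>. a \<in> underS lam (f \<zeta>))"
proof -
  have wo: "Well_order lam" and wo\<kappa>: "Well_order \<kappa>"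
    using lam \<kappa> by (simp_all add: card_order_on_well_order_on)
  obtain A where A: "A \<subseteq> Field lam" "cofinal A lam" "|A| =o \<kappa>"
    using cof by (auto simp: has_cofinality_def)
  have "|Field \<kappa>| =o |A|"
    using A(3) card_of_Field_ordIso[OF \<kappa>(1)] ordIso_symmetric ordIso_transitive by blast
  then obtain e where e: "bij_betw e (Field \<kappa>) A"
    using card_of_ordIso by blast
  have eF: "e \<zeta> \<in> Field lam" if "\<zeta> \<in> Field \<kappa>" for \<zeta>
    using e A(1) that by (auto simp: bij_betw_def)
  define T where "T \<zeta> U = {b, e \<zeta>} \<union> d ` U" for \<zeta> U
  have "wf (\<kappa> - Id)"
    using wo\<kappa> by (simp add: well_order_on_def)
  then obtain f where f: "\<And>\<zeta>. f \<zeta> =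
      (SOME v. v \<in> Field lam \<and> (\<forall>t \<in> T \<zeta> (f ` {\<xi>. (\<xi>, \<zeta>) \<in> \<kappa> - Id}). t \<in> underS lam v))"
    using wfrec_image_exists[of "\<kappa> - Id"
        "\<lambda>\<zeta> U. SOME v. v \<in> Field lam \<and> (\<forall>t \<in> T \<zeta> U. t \<in> underS lam v)"] by blast
  have pred: "{\<xi>. (\<xi>, \<zeta>) \<in> \<kappa> - Id} = underS \<kappa> \<zeta>" for \<zeta>
    by (auto simp: underS_def)
  have good: "f \<zeta> \<in> Field lam \<and> (\<forall>t \<in> T \<zeta> (f ` underS \<kappa> \<zeta>). t \<in> underS lam (f \<zeta>))"
    if "\<zeta> \<in> Field \<kappa>" for \<zeta>
    using \<open>wf (\<kappa> - Id)\<close> that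
  proof (induction \<zeta> rule: wf_induct_rule)
    case (less \<zeta>)
    let ?T = "T \<zeta> (f ` underS \<kappa> \<zeta>)"
    have "d (f \<xi>) \<in> Field lam" if "\<xi> \<in> underS \<kappa> \<zeta>" for \<xi>
    proof -
      have "(\<xi>, \<zeta>) \<in> \<kappa> - Id" "\<xi> \<in> Field \<kappa>"
        using that by (auto simp: underS_def Field_def)
      then show ?thesis
        using less.IH[of \<xi>] d by (auto simp: T_def)
    qed
    then have TF: "?T \<subseteq> Field lam"
      using b eF[OF less.prems] by (auto simp: T_def)
    have "|{b, e \<zeta>}| <o natLeq"
      using finite_iff_ordLess_natLeq[of "{b, e \<zeta>}"] by simp
    moreover have "natLeq \<le>o \<kappa>"
      using natLeq_ordLeq_cinfinite[of \<kappa>] \<kappa> by (simp add: cinfinite_def)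
    ultimately have "|{b, e \<zeta>}| <o \<kappa>"
      by (rule ordLess_ordLeq_trans)
    moreover have "|d ` f ` underS \<kappa> \<zeta>| <o \<kappa>"
    proof -
      have "|d ` f ` underS \<kappa> \<zeta>| \<le>o |underS \<kappa> \<zeta>|"
        unfolding image_image by (rule card_of_image)
      then show ?thesis
        using card_of_underS[OF \<kappa>(1) less.prems] ordLeq_ordLess_trans by blast
    qed
    ultimately have "|?T| <o \<kappa>"
      unfolding T_def using card_of_Un_ordLess_infinite_Field[OF \<kappa>(2,1)] by blast
    then have "\<not> cofinal ?T lam"
      using cof TF not_ordLess_ordLeq unfolding has_cofinality_def by blast
    then have "\<exists>v. v \<in> Field lam \<and> (\<forall>t \<in> ?T. t \<in> underS lam v)"
      using not_cofinal_strict_bound[OF lam TF] by blast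
    then show ?case
      using someI_ex[of "\<lambda>v. v \<in> Field lam \<and> (\<forall>t \<in> ?T. t \<in> underS lam v)"]
      unfolding f[of \<zeta>, unfolded pred, symmetric] by blast
  qed
  have "\<exists>\<zeta> \<in> Field \<kappa>. a \<in> underS lam (f \<zeta>)" if a: "a \<in> Field lam" for a
  proof -
    obtain t where t: "t \<in> A" "a \<noteq> t" "(a, t) \<in> lam"
      using A(2) a by (auto simp: cofinal_def)
    then obtain \<zeta> where \<zeta>: "\<zeta> \<in> Field \<kappa>" "t = e \<zeta>"
      using e by (auto simp: bij_betw_def)
    have "t \<in> underS lam (f \<zeta>)"
      using good[OF \<zeta>(1)] \<zeta>(2) by (simp add: T_def)
    moreover have "a \<in> under lam t"
      using t by (simp add: under_def)
    ultimately have "a \<in> underS lam (f \<zeta>)"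
      using Well_order_under_subset(2)[OF wo] by blast
    then show ?thesis
      using \<zeta>(1) by blast
  qed
  then show ?thesis
    using good by (intro exI[of _ f]) (auto simp: T_def)
qed

theorem theorem1:
  fixes \<kappa> :: "'k rel" and lam :: "'l rel"
  assumes "Card_order \<kappa>" and "Card_order lam"
    and "natLeq <o \<kappa>" and "has_cofinality lam \<kappa>"
    and "ctwo ^c \<kappa> <o lam"
    and "\<exists>D. normal_filter \<kappa> D \<and> nice \<kappa> D"
  shows "arrow2 lam lam omega_plus_one"
  unfolding arrow2_def
proof (rule allI, rule ccontr)
  fix c :: "'l set \<Rightarrow> colour"
  assume neg: "\<not> ((\<exists>X \<subseteq> Field lam. |X| =o lam \<and> (\<forall>p \<in> [X]\<^bsup>2\<^esup>. c p = Red)) \<or>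
        (\<exists>Y \<subseteq> Field lam. Restr lam Y =o omega_plus_one \<and> (\<forall>p \<in> [Y]\<^bsup>2\<^esup>. c p = Green)))"
  then have ng: "no_green lam c"
    by (simp add: no_green_def)
  have no_red: "\<exists>x \<in> X. \<exists>y \<in> X. green c x y" if "X \<subseteq> Field lam" "|X| =o lam" for X
  proof -
    have "\<exists>p \<in> [X]\<^bsup>2\<^esup>. c p \<noteq> Red"
      using neg that by blast
    then have "\<exists>x \<in> X. \<exists>y \<in> X. x \<noteq> y \<and> c {x, y} \<noteq> Red"
      using all_nsets_2_iff[of X "\<lambda>p. c p = Red"] by blast
    then show ?thesis
      using colour.exhaust unfolding green_def by blast
  qed
  have \<kappa>: "infinite (Field \<kappa>)"
    using assms(1,3) ordLess_imp_ordLeq card_of_Field_ordIso[OF assms(1)]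
    by (meson infinite_iff_natLeq_ordLeq ordIso_symmetric ordLeq_ordIso_trans)
  have Pow: "|Pow (Field \<kappa>)| =o ctwo ^c \<kappa>"
    unfolding cexp_def ctwo_def Field_card_of by (rule card_of_Pow_Func)
  have "|Field \<kappa>| <o ctwo ^c \<kappa>"
    using card_of_Pow Pow ordLess_ordIso_trans by blast
  then have "|Field \<kappa>| <o lam"
    using assms(5) ordLess_transitive by blast
  then have \<kappa>lam: "\<kappa> <o lam"
    using card_of_Field_ordIso[OF assms(1)] ordIso_symmetric ordIso_ordLess_trans by blast
  have wo: "Well_order lam"
    using assms(2) by (simp add: card_order_on_well_order_on)
  have lam_inf: "infinite (Field lam)"
    using \<open>|Field \<kappa>| <o lam\<close> \<kappa> card_of_Field_ordIso[OF assms(2)]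
    by (meson card_of_ordLeq_infinite ordIso_symmetric ordLess_imp_ordLeq ordLeq_ordIso_trans)
  have limit: "cardSuc (cardSuc |U| ) <o lam" if U: "infinite U" "|U| <o lam" for U :: "'l set"
  proof -
    have "Cinfinite |U|"
      using U(1) card_of_Card_order[of U] by (simp add: cinfinite_def Field_card_of)
    then have c: "Card_order |U|" "infinite (Field |U| )" "Card_order (cardSuc |U| )"
      "infinite (Field (cardSuc |U| ))"
      using Cinfinite_cardSuc[of "|U|"] by (auto simp: cinfinite_def)
    note cardSuc_less = cardSuc_ordLess_singular[OF assms(2,4) \<kappa>lam]
    show ?thesis
      by (rule cardSuc_less[OF c(3,4) cardSuc_less[OF c(1,2) U(2)]])
  qed
  have "|Pow (Field \<kappa>)| <o lam"
    using Pow assms(5) ordIso_ordLess_trans by blast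
  then obtain b where b: "b \<in> Field lam" "|underS lam b| =o |Pow (Field \<kappa>)|"
    using ordLess_imp_card_of_underS[OF wo] by (metis Field_card_of)
  have Pow_le: "|Pow (Field \<kappa>)| \<le>o |under lam a|" if "b \<in> underS lam a" for a
  proof -
    have "underS lam b \<subseteq> under lam a"
      using Well_order_under_subset(2)[OF wo that] by (auto simp: under_def underS_def)
    then show ?thesis
      using b(2) card_of_mono1 ordIso_symmetric ordIso_ordLeq_trans by blast
  qed
  have inf: "infinite (under lam a)" if "b \<in> underS lam a" for a
    using card_of_ordLeq_infinite[OF Pow_le[OF that]] \<kappa> by simp
  define block where "block a S d \<longleftrightarrow> d \<in> Field lam \<and> S \<subseteq> underS lam d \<and>
      (\<forall>x \<in> S. under lam a \<subseteq> underS lam x) \<and>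
      |S| =o cardSuc (cardSuc |under lam a| ) \<and> (\<forall>x \<in> S. \<forall>y \<in> S. \<not> green c x y)" for a S d
  have "\<exists>S d. block a S d" if "a \<in> Field lam" "b \<in> underS lam a" for a
    unfolding block_def by (rule exists_red_block[OF assms(2) lam_inf ng limit that(1) inf[OF that(2)]])
  then obtain S d where Sd: "\<And>a. a \<in> Field lam \<Longrightarrow> b \<in> underS lam a \<Longrightarrow> block a (S a) (d a)"
    by metis
  have dF: "d a \<in> Field lam" if "a \<in> Field lam" "b \<in> underS lam a" for a
    using Sd[OF that] by (simp add: block_def)
  obtain f where f: "\<And>\<zeta>. \<zeta> \<in> Field \<kappa> \<Longrightarrow> f \<zeta> \<in> Field lam"
      "\<And>\<zeta>. \<zeta> \<in> Field \<kappa> \<Longrightarrow> b \<in> underS lam (f \<zeta>)"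
      "\<And>\<zeta> \<xi>. \<zeta> \<in> Field \<kappa> \<Longrightarrow> \<xi> \<in> underS \<kappa> \<zeta> \<Longrightarrow> d (f \<xi>) \<in> underS lam (f \<zeta>)"
      "\<And>a. a \<in> Field lam \<Longrightarrow> \<exists>\<zeta> \<in> Field \<kappa>. a \<in> underS lam (f \<zeta>)"
    using exists_cofinal_sequence[OF assms(1) \<kappa> assms(2) lam_inf assms(4) b(1), of d, OF dF] by blast
  have bl: "d (f \<zeta>) \<in> Field lam" "S (f \<zeta>) \<subseteq> underS lam (d (f \<zeta>))"
    "\<And>x. x \<in> S (f \<zeta>) \<Longrightarrow> under lam (f \<zeta>) \<subseteq> underS lam x"
    "|S (f \<zeta>)| =o cardSuc (cardSuc |under lam (f \<zeta>)| )"
    "\<And>x y. x \<in> S (f \<zeta>) \<Longrightarrow> y \<in> S (f \<zeta>) \<Longrightarrow> \<not> green c x y" if "\<zeta> \<in> Field \<kappa>" for \<zeta>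
    using Sd[OF f(1,2)[OF that]] by (auto simp: block_def)
  have CN: "Cinfinite |under lam (f \<zeta>)|" if "\<zeta> \<in> Field \<kappa>" for \<zeta>
    using inf[OF f(2)[OF that]] card_of_Card_order[of "under lam (f \<zeta>)"]
    by (simp add: cinfinite_def Field_card_of)
  have SN: "S (f \<xi>) \<subseteq> under lam (f \<zeta>)" if "\<zeta> \<in> Field \<kappa>" "\<xi> \<in> underS \<kappa> \<zeta>" for \<xi> \<zeta>
  proof -
    have "\<xi> \<in> Field \<kappa>"
      using that by (auto simp: underS_def Field_def)
    moreover have "under lam (d (f \<xi>)) \<subseteq> underS lam (f \<zeta>)"
      using Well_order_under_subset(2)[OF wo f(3)[OF that]] .
    ultimately show ?thesis
      using bl(2) by (fastforce simp: under_def underS_def)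
  qed
  interpret red_blocks \<kappa> lam c "\<lambda>\<zeta>. S (f \<zeta>)" "\<lambda>\<zeta>. under lam (f \<zeta>)"
  proof
    show "Well_order \<kappa>"
      using assms(1) by (simp add: card_order_on_well_order_on)
    show "Card_order lam" "no_green lam c"
      by fact+
    show "\<exists>x \<in> X. \<exists>y \<in> X. green c x y" if "X \<subseteq> Field lam" "|X| =o lam" for X
      using no_red that .
    fix \<zeta> assume \<zeta>: "\<zeta> \<in> Field \<kappa>"
    show "S (f \<zeta>) \<subseteq> Field lam"
      using bl(2)[OF \<zeta>] by (auto simp: underS_def Field_def)
    show "\<not> green c x y" if "x \<in> S (f \<zeta>)" "y \<in> S (f \<zeta>)" for x y
      using bl(5)[OF \<zeta> that] .
    show "under lam (f \<zeta>) \<subseteq> underS lam x" if "x \<in> S (f \<zeta>)" for x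
      using bl(3)[OF \<zeta> that] .
    show "infinite (under lam (f \<zeta>))"
      using inf[OF f(2)[OF \<zeta>]] .
    show "|Pow (Field \<kappa>)| \<le>o |under lam (f \<zeta>)|"
      using Pow_le[OF f(2)[OF \<zeta>]] .
    show "S (f \<xi>) \<subseteq> under lam (f \<zeta>)" if "\<xi> \<in> underS \<kappa> \<zeta>" for \<xi>
      using SN[OF \<zeta> that] .
    have C: "Cinfinite (cardSuc |under lam (f \<zeta>)| )"
      using Cinfinite_cardSuc[OF CN[OF \<zeta>]] .
    then show "cardSuc |under lam (f \<zeta>)| <o |S (f \<zeta>)|"
      using cardSuc_greater bl(4)[OF \<zeta>] ordIso_symmetric ordLess_ordIso_trans by blast
    have "stable (cardSuc (cardSuc |under lam (f \<zeta>)| ))"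
      using regularCard_stable regularCard_cardSuc[OF C] Cinfinite_cardSuc[OF C]
      by (auto simp: cinfinite_def)
    then show "stable |S (f \<zeta>)|"
      using stable_ordIso1 bl(4)[OF \<zeta>] by blast
  next
    fix a assume "a \<in> Field lam"
    then obtain \<alpha> where \<alpha>: "\<alpha> \<in> Field \<kappa>" "a \<in> underS lam (f \<alpha>)"
      using f(4) by blast
    have "|underS lam a| \<le>o |under lam (f \<zeta>)|" if "\<zeta> \<in> aboveS \<kappa> \<alpha>" for \<zeta>
    proof (rule card_of_mono1)
      have \<zeta>: "\<zeta> \<in> Field \<kappa>" "\<alpha> \<in> underS \<kappa> \<zeta>"
        using that by (auto simp: aboveS_def underS_def Field_def)
      have "infinite (S (f \<alpha>))"
        using bl(4)[OF \<alpha>(1)] Cinfinite_cardSuc[OF Cinfinite_cardSuc[OF CN[OF \<alpha>(1)]]]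
        by (metis Field_card_of card_of_Field_ordIso card_of_ordIso_finite cinfinite_def
            ordIso_symmetric ordIso_transitive)
      then obtain x where x: "x \<in> S (f \<alpha>)"
        by fastforce
      have "underS lam a \<subseteq> under lam (f \<alpha>)"
        using Well_order_under_subset(2)[OF wo \<alpha>(2)] by (auto simp: under_def underS_def)
      also have "\<dots> \<subseteq> under lam x"
        using bl(3)[OF \<alpha>(1) x] by (auto simp: under_def underS_def)
      also have "\<dots> \<subseteq> under lam (f \<zeta>)"
        using Well_order_under_subset(1)[OF wo] SN[OF \<zeta>] x by blast
      finally show "underS lam a \<subseteq> under lam (f \<zeta>)" .
    qed
    then show "\<exists>\<alpha> \<in> Field \<kappa>. \<forall>\<zeta> \<in> aboveS \<kappa> \<alpha>. |underS lam a| \<le>o |under lam (f \<zeta>)|"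
      using \<alpha>(1) by blast
  qed
  show False
    using no_nice_filter \<kappa> assms(6) by blast
qed

end
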